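(* Let $n\geq 2$ be an integer and let $\mathbb{K}$ be a field of characteristic $p>0$ with $p>3^{\varphi(n^2-n)}$, where $\varphi$ is Euler's totient function. If a $4$-net $\lambda$ of order $n$ is embedded in $PG(2,\mathbb{K})$, then $-3$ is a square in $\mathbb{K}$ and the constant cross-ratio $\kappa$ of $\lambda$ satisfies $\kappa^2-\kappa+1=0$.
   Context: $PG(2,\mathbb{K})$ is the projective plane over the field $\mathbb{K}$. For $k\geq 3$, a $k$-net of order $n$ embedded in $PG(2,\mathbb{K})$ is a $k$-tuple $\lambda=(\lambda_1,\ldots,\lambda_k)$ of pairwise disjoint sets of lines of $PG(2,\mathbb{K})$ (called components), each of the same size $n$, such that any two lines from distinct components are concurrent with exactly one line from each component: if $\ell\in\lambda_i$, $m\in\lambda_j$ with $i\neq j$, then through the point $\ell\cap m$ there passes exactly one line of each of $\lambda_1,\ldots,\lambda_k$. The points of the net $\lambda$ are the $n^2$ points $\ell\cap m$ of this kind. Cross-ratio of four distinct concurrent lines $\ell_1,\ell_2,\ell_3,\ell_4$: choose linear forms $r,w$ such that $\ell_1,\ell_2,\ell_3$ have equations $r=0$, $w=0$, $r+w=0$; then $(\ell_1,\ell_2,\ell_3,\ell_4)$ is the unique $\kappa\in\mathbb{K}\setminus\{0,1\}$ such that $\ell_4$ has equation $\kappa r+w=0$. For a $4$-net $\lambda=(\lambda_1,\lambda_2,\lambda_3,\lambda_4)$ the cross-ratio $(\ell_1,\ell_2,\ell_3,\ell_4)$ of the four lines $\ell_i\in\lambda_i$ through a point $P$ of $\lambda$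 does not depend on the choice of $P$; the common value $\kappa$ is called the constant cross-ratio of $\lambda$. *)

theory Defs
  imports "HOL-Analysis.Analysis" "HOL-Number_Theory.Totient"
begin

text \<open>
  The projective plane over a field: points and lines are the subspaces of dimension 1 and 2
  of the three-dimensional coordinate space, and incidence is inclusion. Two distinct lines
  \<open>l\<close>, \<open>m\<close> meet in the point \<open>l \<inter> m\<close>.
\<close>

definition pg_points :: "('a::field ^ 3) set set" where
  "pg_points = {P. vec.subspace P \<and> vec.dim P = 1}"

definition pg_lines :: "('a::field ^ 3) set set" where
  "pg_lines = {l. vec.subspace l \<and> vec.dim l = 2}"

abbreviation linear_form :: "('a::field ^ 3 \<Rightarrow> 'a) \<Rightarrow> bool" where
  "linear_form \<equiv> Vector_Spaces.linear (*s) (*)"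

definition concurrent :: "('a::field ^ 3) set set \<Rightarrow> bool" where
  "concurrent L \<longleftrightarrow> (\<exists>P\<in>pg_points. \<forall>l\<in>L. P \<subseteq> l)"

text \<open>
  The forms \<open>r\<close> and \<open>w\<close> are determined by the first three lines up to a common nonzero
  factor, so at most one \<open>\<kappa>\<close> satisfies the following relation.
\<close>

definition is_cross_ratio ::
  "('a::field ^ 3) set \<Rightarrow> ('a ^ 3) set \<Rightarrow> ('a ^ 3) set \<Rightarrow> ('a ^ 3) set \<Rightarrow> 'a \<Rightarrow> bool" where
  "is_cross_ratio l1 l2 l3 l4 \<kappa> \<longleftrightarrow>
     {l1, l2, l3, l4} \<subseteq> pg_lines \<and> distinct [l1, l2, l3, l4] \<and> concurrent {l1, l2, l3, l4} \<and>
     \<kappa> \<noteq> 0 \<and> \<kappa> \<noteq> 1 \<and>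
     (\<exists>r w. linear_form r \<and> linear_form w \<and>
        l1 = {x. r x = 0} \<and> l2 = {x. w x = 0} \<and> l3 = {x. r x + w x = 0} \<and>
        l4 = {x. \<kappa> * r x + w x = 0})"

text \<open>
  A \<open>k\<close>-tuple of components is a function on indices, of which only the values at
  \<open>1, \<dots>, k\<close> matter.
\<close>

definition is_net :: "nat \<Rightarrow> nat \<Rightarrow> (nat \<Rightarrow> ('a::field ^ 3) set set) \<Rightarrow> bool" where
  "is_net k n \<Lambda> \<longleftrightarrow>
     3 \<le> k \<and>
     (\<forall>i\<in>{1..k}. \<Lambda> i \<subseteq> pg_lines \<and> finite (\<Lambda> i) \<and> card (\<Lambda> i) = n) \<and>
     (\<forall>i\<in>{1..k}. \<forall>j\<in>{1..k}. i \<noteq> j \<longrightarrow> \<Lambda> i \<inter> \<Lambda> j = {}) \<and>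
     (\<forall>i\<in>{1..k}. \<forall>j\<in>{1..k}. i \<noteq> j \<longrightarrow>
        (\<forall>l\<in>\<Lambda> i. \<forall>m\<in>\<Lambda> j. \<forall>h\<in>{1..k}. \<exists>!t. t \<in> \<Lambda> h \<and> l \<inter> m \<subseteq> t))"

definition net_points :: "nat \<Rightarrow> (nat \<Rightarrow> ('a::field ^ 3) set set) \<Rightarrow> ('a ^ 3) set set" where
  "net_points k \<Lambda> =
     {l \<inter> m | l m i j. i \<in> {1..k} \<and> j \<in> {1..k} \<and> i \<noteq> j \<and> l \<in> \<Lambda> i \<and> m \<in> \<Lambda> j}"

definition is_constant_cross_ratio :: "(nat \<Rightarrow> ('a::field ^ 3) set set) \<Rightarrow> 'a \<Rightarrow> bool" where
  "is_constant_cross_ratio \<Lambda> \<kappa> \<longleftrightarrow>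
     (\<forall>P\<in>net_points 4 \<Lambda>. \<forall>l1\<in>\<Lambda> 1. \<forall>l2\<in>\<Lambda> 2. \<forall>l3\<in>\<Lambda> 3. \<forall>l4\<in>\<Lambda> 4.
        P \<subseteq> l1 \<and> P \<subseteq> l2 \<and> P \<subseteq> l3 \<and> P \<subseteq> l4 \<longrightarrow> is_cross_ratio l1 l2 l3 l4 \<kappa>)"

end

theory Submission
  imports Defs
begin

text \<open>
  Let a net line \<open>t\<close> of a third component pass through the meet of \<open>l\<close> and \<open>m\<close>, so that its form
  is \<open>\<alpha> l + \<beta> m\<close>. On \<open>m\<close> the product of the forms of the third component is \<open>\<Prod>\<^sub>l \<alpha>\<close> times that of
  the first one, and evaluating at the meet of two lines \<open>m\<close> shows that \<open>\<Prod>\<^sub>l \<alpha>\<close> is the same for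
  all \<open>m\<close>; likewise for \<open>\<Prod>\<^sub>m \<beta>\<close>. Cancelling the factors vanishing at the net point gives
  \<open>\<alpha> / \<beta>\<close> there up to a quantity that is independent of the third component. Comparing the third
  and fourth components shows that the cross-ratio \<open>\<kappa>\<close> is constant, and multiplying its expression
  over all \<open>n\<^sup>2\<close> net points gives \<open>\<kappa> ^ (n\<^sup>2 - n) = 1\<close>. Exchanging two components replaces \<open>\<kappa>\<close> by
  \<open>1 - \<kappa>\<close>, which is therefore a root of unity as well.

  Thus \<open>g ^ i + g ^ j = 1\<close> for an element \<open>g\<close> of some order \<open>m\<close> dividing \<open>N = n\<^sup>2 - n\<close>. The integer
  \<open>\<Prod>\<^sub>\<zeta> (1 - \<zeta> ^ i - \<zeta> ^ j)\<close>, over the primitive complex \<open>m\<close>-th roots of unity \<open>\<zeta>\<close>, is then divisible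
  by \<open>p\<close> but at most \<open>3 ^ \<phi>(N) < p\<close> in absolute value. So it vanishes, which makes \<open>\<zeta> ^ i\<close> a primitive
  sixth root of unity for some \<open>\<zeta>\<close>; hence so is \<open>g ^ i = \<kappa>\<close>.
\<close>

section \<open>Cyclotomic polynomials and roots of unity\<close>

lemma map_poly_of_int_mult:
  "map_poly of_int (p * q) = (map_poly of_int p * map_poly of_int q :: 'a::comm_ring_1 poly)"
  by (intro poly_eqI) (simp add: coeff_map_poly coeff_mult)

lemma map_poly_of_int_add:
  "map_poly of_int (p + q) = (map_poly of_int p + map_poly of_int q :: 'a::comm_ring_1 poly)"
  by (intro poly_eqI) (simp add: coeff_map_poly)

lemma map_poly_of_int_diff:
  "map_poly of_int (p - q) = (map_poly of_int p - map_poly of_int q :: 'a::comm_ring_1 poly)"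
  by (intro poly_eqI) (simp add: coeff_map_poly)

lemma map_poly_of_int_1: "map_poly of_int 1 = (1 :: 'a::comm_ring_1 poly)"
  by simp

lemma map_poly_of_int_monom: "map_poly of_int (monom 1 n) = (monom 1 n :: 'a::comm_ring_1 poly)"
  by (simp add: map_poly_monom)

lemma map_poly_of_int_prod:
  "map_poly of_int (prod f A) = (\<Prod>x\<in>A. map_poly of_int (f x) :: 'a::comm_ring_1 poly)"
  by (induction A rule: infinite_finite_induct) (simp_all add: map_poly_of_int_mult)

lemma map_poly_of_int_eq_iff:
  "map_poly of_int p = (map_poly of_int q :: 'a::{comm_ring_1,ring_char_0} poly) \<longleftrightarrow> p = q"
  by (auto simp: poly_eq_iff coeff_map_poly)

lemma degree_map_poly_of_int:
  "degree (map_poly of_int p :: 'a::{comm_ring_1,ring_char_0} poly) = degree p"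
  by (rule degree_map_poly) auto

lemma lead_coeff_map_poly_of_int:
  "lead_coeff (map_poly of_int p :: 'a::{comm_ring_1,ring_char_0} poly) = of_int (lead_coeff p)"
  by (simp add: degree_map_poly_of_int coeff_map_poly)

text \<open>Pseudo-division scales \<open>f\<close> by a power of the leading coefficient of
  \<open>g\<close>; for monic \<open>g\<close> it is therefore genuine division with remainder over
  the integers.\<close>

lemma monic_division:
  fixes f g :: "int poly"
  assumes "lead_coeff g = 1"
  obtains q r where "f = g * q + r" "r = 0 \<or> degree r < degree g"
proof -
  obtain q r where qr: "pseudo_divmod f g = (q, r)"
    by fastforce
  have "g \<noteq> 0"
    using assms by auto
  from pseudo_divmod[OF this qr] assms that show ?thesis
    by auto
qed

section \<open>Multiplicative orders and roots of unity in a field\<close>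

text \<open>The condition \<open>d > 0\<close> excludes elements of infinite order and zero, all of
  which satisfy the equivalence with \<open>d = 0\<close>.\<close>

definition has_order :: "nat \<Rightarrow> 'a::field \<Rightarrow> bool" where
  "has_order d x \<longleftrightarrow> d > 0 \<and> (\<forall>k. x ^ k = 1 \<longleftrightarrow> d dvd k)"

lemma has_orderD: "has_order d x \<Longrightarrow> x ^ k = 1 \<longleftrightarrow> d dvd k" "has_order d x \<Longrightarrow> d > 0"
  by (auto simp: has_order_def)

lemma has_order_unique: "has_order d x \<Longrightarrow> has_order e x \<Longrightarrow> d = e"
  unfolding has_order_def by (metis dvd_antisym dvd_refl)

lemma has_order_exists:
  fixes x :: "'a::field"
  assumes "x ^ n = 1" "n > 0"
  obtains d where "has_order d x" "d dvd n"
proof -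
  define d where "d = (LEAST d. d > 0 \<and> x ^ d = 1)"
  have d: "d > 0 \<and> x ^ d = 1"
    unfolding d_def using assms by (intro LeastI) auto
  have le: "d \<le> k" if "k > 0" "x ^ k = 1" for k
    unfolding d_def using that by (intro Least_le) auto
  have "d dvd k" if k: "x ^ k = 1" for k
  proof -
    have "x ^ k = (x ^ d) ^ (k div d) * x ^ (k mod d)"
      by (simp flip: power_mult power_add)
    then have "x ^ (k mod d) = 1"
      using d k by simp
    then have "k mod d = 0"
      using le[of "k mod d"] d mod_less_divisor[of d k] by linarith
    then show ?thesis
      by auto
  qed
  then have "has_order d x"
    using d by (auto simp: has_order_def power_mult elim!: dvdE)
  then show ?thesis
    using that assms by (auto simp: has_order_def)
qed

lemma has_order_power:
  assumes x: "has_order d x" and a: "coprime a d"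
  shows "has_order d (x ^ a)"
  using assms by (auto simp: has_order_def coprime_dvd_mult_right_iff coprime_commute
      simp flip: power_mult)

lemma has_order_inj_on:
  assumes x: "has_order d x"
  shows "inj_on (\<lambda>k. x ^ k) {..<d}"
proof -
  have nz: "x \<noteq> 0"
    using x by (metis dvd_refl has_order_def power_0_left zero_neq_one less_numeral_extra(3))
  have "i = j" if "i \<le> j" "j < d" "x ^ i = x ^ j" for i j
  proof -
    have "x ^ i * x ^ (j - i) = x ^ i"
      using that by (metis le_add_diff_inverse power_add)
    then have "x ^ (j - i) = 1"
      using nz by simp
    then have "d dvd j - i"
      using x by (simp add: has_order_def)
    then show ?thesis
      using that by (metis diff_is_0_eq dvd_imp_le le_antisym less_imp_diff_less not_less neq0_conv)
  qed
  then show ?thesis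
    unfolding inj_on_def by (metis lessThan_iff nle_le)
qed

lemma degree_lead_coeff_monom_minus_1:
  assumes "n > 0"
  shows "degree (monom 1 n - 1 :: 'a::comm_ring_1 poly) = n"
    "lead_coeff (monom 1 n - 1 :: 'a poly) = 1"
proof -
  have "degree (- 1 + monom 1 n :: 'a poly) = degree (monom 1 n :: 'a poly)"
    using assms by (intro degree_add_eq_right) (simp add: degree_monom_eq)
  then show d: "degree (monom 1 n - 1 :: 'a poly) = n"
    by (simp add: degree_monom_eq)
  show "lead_coeff (monom 1 n - 1 :: 'a poly) = 1"
    using assms by (simp add: d)
qed

lemma finite_card_roots_of_unity:
  assumes "n > 0"
  shows "finite {x::'a::field. x ^ n = 1}" "card {x::'a::field. x ^ n = 1} \<le> n"
proof -
  define f :: "'a poly" where "f = monom 1 n - 1"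
  have deg: "degree f = n"
    unfolding f_def by (rule degree_lead_coeff_monom_minus_1[OF assms])
  then have nz: "f \<noteq> 0"
    using assms by auto
  have eq: "{x::'a. x ^ n = 1} = {x. poly f x = 0}"
    by (auto simp: f_def poly_monom)
  show "finite {x::'a::field. x ^ n = 1}" "card {x::'a::field. x ^ n = 1} \<le> n"
    unfolding eq using poly_roots_finite[OF nz] card_poly_roots_bound[OF nz] deg by auto
qed

text \<open>The \<open>d\<close> distinct powers of \<open>x\<close> already exhaust the at most
  \<open>d\<close> roots of \<open>X ^ d - 1\<close>.\<close>

lemma roots_of_unity_eq_powers:
  fixes x :: "'a::field"
  assumes x: "has_order d x"
  shows "{z. z ^ d = 1} = (\<lambda>k. x ^ k) ` {..<d}"
proof -
  have d: "d > 0"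
    using x by (simp add: has_order_def)
  have sub: "(\<lambda>k. x ^ k) ` {..<d} \<subseteq> {z. z ^ d = 1}"
    using x by (auto simp: has_order_def simp flip: power_mult)
  have "card ((\<lambda>k. x ^ k) ` {..<d}) = d"
    using has_order_inj_on[OF x] by (simp add: card_image)
  then show ?thesis
    using sub finite_card_roots_of_unity[OF d] card_seteq by metis
qed

text \<open>This turns a product over the elements of order \<open>d\<close> into one over exponents
  prime to \<open>d\<close>, a form in which an integer polynomial can be written down and evaluated
  in any field.\<close>

lemma has_order_bij_betw:
  fixes x :: "'a::field"
  assumes x: "has_order d x"
  shows "bij_betw (\<lambda>k. x ^ k) (totatives d) {z. has_order d z}"
proof -
  have d: "d > 0" and xd: "x ^ d = 1"
    using x by (auto simp: has_order_def)
  have per: "x ^ k = x ^ (k mod d)" for k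
  proof -
    have "x ^ k = (x ^ d) ^ (k div d) * x ^ (k mod d)"
      by (simp flip: power_mult power_add)
    then show ?thesis using xd by simp
  qed
  have "inj_on (\<lambda>k. x ^ k) (totatives d)"
  proof (rule inj_onI)
    fix i j assume ij: "i \<in> totatives d" "j \<in> totatives d" "x ^ i = x ^ j"
    then have "i mod d = j mod d"
      using has_order_inj_on[OF x] per[of i] per[of j] d
      by (metis inj_onD lessThan_iff mod_less_divisor)
    \<comment> \<open>Totatives of \<open>d\<close> lie below \<open>d\<close> except for
      \<open>d = 1\<close>, whose only totative is \<open>1\<close>.\<close>
    then show "i = j"
      using ij(1,2) totatives_less[of i d] totatives_less[of j d] d
      by (cases "d = 1") auto
  qed
  moreover have "(\<lambda>k. x ^ k) ` totatives d = {z. has_order d z}"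
  proof (intro equalityI subsetI)
    fix z :: 'a assume "z \<in> (\<lambda>k. x ^ k) ` totatives d"
    then show "z \<in> {z. has_order d z}"
      using has_order_power[OF x] by (auto simp: in_totatives_iff)
  next
    fix z :: 'a assume "z \<in> {z. has_order d z}"
    then have z: "has_order d z" by simp
    then have "z ^ d = 1"
      by (auto simp: has_order_def)
    then obtain k where k: "k < d" "z = x ^ k"
      using roots_of_unity_eq_powers[OF x] by blast
    \<comment> \<open>A common factor \<open>g\<close> gives \<open>z ^ (d div g) = 1\<close>, which
      the order of \<open>z\<close> permits only for \<open>g = 1\<close>.\<close>
    define g where "g = gcd k d"
    have "g > 0" "g dvd k" "g dvd d"
      using d by (auto simp: g_def)
    have "d dvd k * (d div g)"
      using \<open>g dvd k\<close> \<open>g dvd d\<close>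
        by (metis dvd_div_mult dvd_triv_right div_mult_swap dvd_mult_div_cancel mult.commute)
    then have "z ^ (d div g) = 1"
      using x k by (simp add: has_order_def flip: power_mult)
    then have "d dvd d div g"
      using z by (simp add: has_order_def)
    then have "g = 1"
      using d \<open>g > 0\<close> \<open>g dvd d\<close>
      by (metis One_nat_def div_less_dividend dvd_div_eq_0_iff dvd_imp_le linorder_not_less nat_less_le
          not_gr0 less_one linorder_neqE_nat)
    then have cop: "coprime k d"
      by (simp add: g_def coprime_iff_gcd_eq_1)
    show "z \<in> (\<lambda>k. x ^ k) ` totatives d"
    \<comment> \<open>Exponent \<open>0\<close> is no totative. It is coprime to \<open>d\<close>
      only for \<open>d = 1\<close>, where exponent \<open>1\<close> gives the same power.\<close>
    proof (cases "k = 0")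
      case True
      then have "d = 1" using cop by simp
      then show ?thesis using True k xd by (auto simp: image_iff)
    next
      case False
      then show ?thesis using k cop by (auto simp: in_totatives_iff)
    qed
  qed
  ultimately show ?thesis
    by (simp add: bij_betw_def)
qed

lemma has_order_cis:
  assumes "n > 0"
  shows "has_order n (cis (2 * pi / n))"
proof -
  have "cis (2 * pi / n) ^ k = 1 \<longleftrightarrow> n dvd k" for k
  proof -
    have "cis (2 * pi / n) ^ k = cis (real k * (2 * pi / n))"
      by (rule Complex.DeMoivre)
    also have "\<dots> = exp (2 * of_real pi * \<i> * (of_nat k / of_nat n))"
      by (simp add: cis_conv_exp mult_ac)
    finally show ?thesis
      using complex_root_unity_eq_1[of n k] assms by (simp add: mult.assoc)
  qed
  then show ?thesis
    using assms by (simp add: has_order_def)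
qed

section \<open>Cyclotomic polynomials, complex and integral\<close>

definition complex_cyclotomic :: "nat \<Rightarrow> complex poly" where
  "complex_cyclotomic d = (\<Prod>z | has_order d z. [:-z, 1:])"

lemma finite_has_order: "finite {z::'a::field. has_order d z}"
proof (cases "d > 0")
  case True
  have "{z::'a. has_order d z} \<subseteq> {z. z ^ d = 1}"
    unfolding has_order_def by (rule Collect_mono) simp
  then show ?thesis
    using finite_card_roots_of_unity(1)[OF True] by (rule finite_subset)
next
  case False
  then show ?thesis
    unfolding has_order_def by simp
qed

lemma monic_prod_linear:
  "lead_coeff (\<Prod>x\<in>A. [:- x, 1:] :: 'a::idom poly) = 1"
  "degree (\<Prod>x\<in>A. [:- x, 1:] :: 'a::idom poly) = card A"
proof -
  show "lead_coeff (\<Prod>x\<in>A. [:- x, 1:] :: 'a::idom poly) = 1"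
    unfolding lead_coeff_prod by simp
  show "degree (\<Prod>x\<in>A. [:- x, 1:] :: 'a::idom poly) = card A"
    by (simp add: degree_prod_eq_sum_degree)
qed

lemma card_has_order_complex:
  assumes "n > 0"
  shows "card {z::complex. has_order n z} = totient n"
  using bij_betw_same_card[OF has_order_bij_betw[OF has_order_cis[OF assms]]]
  by (simp add: totient_def)

lemma degree_complex_cyclotomic: "n > 0 \<Longrightarrow> degree (complex_cyclotomic n) = totient n"
  by (simp add: complex_cyclotomic_def monic_prod_linear card_has_order_complex)

lemma lead_coeff_complex_cyclotomic: "lead_coeff (complex_cyclotomic n) = 1"
  unfolding complex_cyclotomic_def by (rule monic_prod_linear)

text \<open>Both sides are monic of degree \<open>n\<close> and agree at the \<open>n\<close> roots
  of unity.\<close>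

lemma prod_linear_roots_unity:
  assumes "n > 0"
  shows "(\<Prod>z | z ^ n = 1. [:-z, 1:]) = (monom 1 n - 1 :: complex poly)"
proof -
  let ?U = "{z::complex. z ^ n = 1}"
  have c: "card ?U = n"
    using card_complex_roots_unity[of n] assms by simp
  have fin: "finite ?U"
    using finite_card_roots_of_unity assms by blast
  have d: "degree (\<Prod>z\<in>?U. [:-z, 1:]) = n" "lead_coeff (\<Prod>z\<in>?U. [:-z, 1:]) = 1"
    unfolding monic_prod_linear(1) by (simp_all only: monic_prod_linear(2) c)
  show ?thesis
  proof (rule poly_eqI_degree_lead_coeff[where A = ?U and n = n])
    show "coeff (\<Prod>z\<in>?U. [:-z, 1:]) n = coeff (monom 1 n - 1 :: complex poly) n"
      using d degree_lead_coeff_monom_minus_1[OF assms, where ?'a = complex] by metis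
    show "poly (\<Prod>z\<in>?U. [:-z, 1:]) z = poly (monom 1 n - 1) z" if "z \<in> ?U" for z
    proof -
      have "(\<Prod>x\<in>?U. poly [:-x, 1:] z) = 0"
        using that fin by (intro prod_zero) auto
      then show ?thesis
        using that by (simp add: poly_prod poly_monom)
    qed
    show "degree (monom 1 n - 1 :: complex poly) \<le> n"
      using degree_lead_coeff_monom_minus_1[OF assms, where ?'a = complex] by simp
  qed (simp_all only: c d order_refl)
qed

text \<open>Every \<open>n\<close>-th root of unity has exactly one order, and that order divides
  \<open>n\<close>.\<close>

lemma prod_complex_cyclotomic:
  assumes "n > 0"
  shows "(\<Prod>d | d dvd n. complex_cyclotomic d) = monom 1 n - 1"
proof -
  have "(\<Prod>d | d dvd n. complex_cyclotomic d)
      = (\<Prod>z\<in>(\<Union>d\<in>{d. d dvd n}. {z. has_order d z}). [:-z, 1:])"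
    unfolding complex_cyclotomic_def
  proof (rule prod.UNION_disjoint [symmetric])
    show "finite {d. d dvd n}" using assms by simp
  qed (auto simp: finite_has_order dest: has_order_unique)
  also have "(\<Union>d\<in>{d. d dvd n}. {z::complex. has_order d z}) = {z. z ^ n = 1}"
  proof (intro equalityI subsetI)
    fix z :: complex
    assume "z \<in> (\<Union>d\<in>{d. d dvd n}. {z. has_order d z})"
    then show "z \<in> {z. z ^ n = 1}"
      by (auto simp: has_order_def)
  next
    fix z :: complex
    assume "z \<in> {z. z ^ n = 1}"
    then show "z \<in> (\<Union>d\<in>{d. d dvd n}. {z. has_order d z})"
      using has_order_exists[of z n] assms by blast
  qed
  finally show ?thesis
    by (simp add: prod_linear_roots_unity assms)
qed

text \<open>By induction the factors for proper divisors of \<open>n\<close> multiply to a monic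
  integer polynomial \<open>P\<close>. The complex quotient of \<open>X ^ n - 1\<close> by
  \<open>P\<close> must then agree with the quotient \<open>q\<close> computed over the
  integers.\<close>

lemma cyclotomic_int_exists:
  "n > 0 \<Longrightarrow> \<exists>f::int poly. map_poly of_int f = complex_cyclotomic n"
proof (induction n rule: less_induct)
  case (less n)
  define D where "D = {d. d dvd n \<and> d < n}"
  have D: "{d. d dvd n} = insert n D" "n \<notin> D" "finite D"
    using less.prems by (auto simp: D_def dest: dvd_imp_le)
  have "\<exists>f::int poly. map_poly of_int f = complex_cyclotomic d" if "d \<in> D" for d
    using less that by (auto simp: D_def intro!: less.IH dest: dvd_pos_nat)
  then obtain f :: "nat \<Rightarrow> int poly" where f: "\<And>d. d \<in> D \<Longrightarrow> map_poly of_int (f d) = complex_cyclotomic d"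
    by metis
  define P where "P = prod f D"
  have P: "map_poly of_int P = prod complex_cyclotomic D"
    by (simp add: P_def map_poly_of_int_prod f)
  then have "of_int (lead_coeff P) = lead_coeff (prod complex_cyclotomic D)"
    using lead_coeff_map_poly_of_int by metis
  then have "lead_coeff P = 1"
    by (simp add: lead_coeff_prod lead_coeff_complex_cyclotomic)
  then obtain q r where qr: "monom 1 n - 1 = P * q + r" "r = 0 \<or> degree r < degree P"
    using monic_division by blast
  let ?P = "map_poly of_int P :: complex poly" and ?q = "map_poly of_int q :: complex poly"
    and ?r = "map_poly of_int r :: complex poly"
  have "?P * complex_cyclotomic n = monom 1 n - 1"
    using prod_complex_cyclotomic[OF less.prems] D by (simp add: P mult.commute)
  also have "\<dots> = map_poly of_int (monom 1 n - 1)"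
    by (simp add: map_poly_of_int_diff map_poly_of_int_monom)
  also have "\<dots> = ?P * ?q + ?r"
    by (simp add: qr map_poly_of_int_add map_poly_of_int_mult)
  finally have eq: "?P * (complex_cyclotomic n - ?q) = ?r"
    by (simp add: algebra_simps)
  have "complex_cyclotomic n - ?q = 0"
  \<comment> \<open>A nonzero difference would force the remainder to have degree at least
    \<open>degree P\<close>.\<close>
  proof (rule ccontr)
    assume nz: "complex_cyclotomic n - ?q \<noteq> 0"
    have "?P \<noteq> 0"
      using \<open>lead_coeff P = 1\<close> map_poly_of_int_eq_iff[of P 0, where ?'a = complex] by auto
    then have "degree P \<le> degree ?r" "?r \<noteq> 0"
      using nz degree_mult_eq[OF _ nz, of ?P] by (auto simp: degree_map_poly_of_int simp flip: eq)
    with qr(2) show False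
      by (auto simp: degree_map_poly_of_int)
  qed
  then show ?case
    by (metis eq_iff_diff_eq_0)
qed

definition cyclotomic :: "nat \<Rightarrow> int poly" where
  "cyclotomic n = (SOME f. map_poly of_int f = complex_cyclotomic n)"

lemma map_poly_cyclotomic: "n > 0 \<Longrightarrow> map_poly of_int (cyclotomic n) = complex_cyclotomic n"
  unfolding cyclotomic_def by (rule someI_ex) (rule cyclotomic_int_exists)

lemma prod_cyclotomic:
  assumes "n > 0"
  shows "(\<Prod>d | d dvd n. cyclotomic d) = monom 1 n - 1"
proof -
  have "map_poly of_int (\<Prod>d | d dvd n. cyclotomic d) = (\<Prod>d | d dvd n. complex_cyclotomic d)"
    unfolding map_poly_of_int_prod using assms
    by (intro prod.cong) (auto simp: map_poly_cyclotomic dest: dvd_pos_nat)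
  also have "\<dots> = map_poly of_int (monom 1 n - 1)"
    by (simp add: prod_complex_cyclotomic assms map_poly_of_int_diff map_poly_of_int_monom)
  finally show ?thesis
    by (simp only: map_poly_of_int_eq_iff)
qed

lemma lead_coeff_cyclotomic: "n > 0 \<Longrightarrow> lead_coeff (cyclotomic n) = 1"
  using lead_coeff_map_poly_of_int[of "cyclotomic n", where ?'a = complex]
    lead_coeff_complex_cyclotomic[of n]
  by (simp only: map_poly_cyclotomic) simp

lemma degree_cyclotomic: "n > 0 \<Longrightarrow> degree (cyclotomic n) = totient n"
  by (metis degree_complex_cyclotomic degree_map_poly_of_int map_poly_cyclotomic)

text \<open>Here \<open>m\<close> counts the \<open>n\<close>-th roots of unity present in the
  field. The generator is sought outside the zeros of the cyclotomic factors of
  \<open>X ^ m - 1\<close> for proper divisors of \<open>m\<close>; this makes it a root of the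
  remaining factor as well as an element of order \<open>m\<close>.\<close>

lemma roots_of_unity_generator:
  fixes n :: nat
  assumes "n > 0"
  obtains g :: "'a::field" and m where "has_order m g" "m dvd n"
    "poly (map_poly of_int (cyclotomic m)) g = 0" "\<And>x. x ^ n = 1 \<Longrightarrow> \<exists>i. x = g ^ i"
proof -
  define U where "U = {x::'a. x ^ n = 1}"
  define m where "m = card U"
  have fin: "finite U" and "1 \<in> U"
    using finite_card_roots_of_unity(1)[OF assms] by (auto simp: U_def)
  then have m: "m > 0"
    by (auto simp: m_def card_gt_0_iff)
  have U0: "x \<noteq> 0" if "x \<in> U" for x
    using that assms by (auto simp: U_def zero_power)
  have Um: "x ^ m = 1" if x: "x \<in> U" for x
  proof -
    \<comment> \<open>Multiplication by \<open>x\<close> permutes \<open>U\<close>, so the product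
      of all elements of \<open>U\<close> is unchanged by the factor \<open>x ^ m\<close>.\<close>
    have "bij_betw (\<lambda>y. x * y) U U"
    proof (rule bij_betw_byWitness[where f' = "\<lambda>y. y / x"])
    qed (use x U0 in \<open>auto simp: U_def power_mult_distrib power_divide\<close>)
    then have "(\<Prod>y\<in>U. x * y) = \<Prod>U"
      by (rule prod.reindex_bij_betw)
    then have "x ^ m * \<Prod>U = \<Prod>U"
      by (simp add: prod.distrib m_def)
    moreover have "\<Prod>U \<noteq> 0"
      using U0 fin by (auto simp: prod_zero_iff)
    ultimately show ?thesis by simp
  qed
  let ?c = "map_poly of_int :: int poly \<Rightarrow> 'a poly"
  define P where "P = (\<Prod>d | d dvd m \<and> d < m. ?c (cyclotomic d))"
  have D: "{d. d dvd m} = insert m {d. d dvd m \<and> d < m}"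
    using m by (auto dest: dvd_imp_le)
  have eq: "?c (cyclotomic m) * P = monom 1 m - 1"
  proof -
    have "monom 1 m - 1 = ?c (\<Prod>d | d dvd m. cyclotomic d)"
      using m by (simp add: prod_cyclotomic map_poly_of_int_diff map_poly_of_int_monom)
    also have "\<dots> = ?c (cyclotomic m) * P"
      unfolding map_poly_of_int_prod D P_def by (subst prod.insert) auto
    finally show ?thesis by simp
  qed
  \<comment> \<open>Otherwise \<open>P\<close> would have \<open>m\<close> roots, although its
    degree is at most \<open>m - totient m\<close>.\<close>
  have "\<exists>g\<in>U. poly P g \<noteq> 0"
  proof (rule ccontr)
    assume "\<not> ?thesis"
    then have sub: "U \<subseteq> {x. poly P x = 0}" by auto
    have nz: "P \<noteq> 0"
      using eq degree_lead_coeff_monom_minus_1[OF m, where ?'a = 'a] m by force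
    then have "m \<le> degree P"
      using card_mono[OF poly_roots_finite[OF nz] sub] card_poly_roots_bound[OF nz] by (simp add: m_def)
    moreover have "?c (cyclotomic m) \<noteq> 0"
      using eq degree_lead_coeff_monom_minus_1[OF m, where ?'a = 'a] m by force
    then have "m = degree (?c (cyclotomic m)) + degree P"
      using degree_mult_eq nz eq degree_lead_coeff_monom_minus_1[OF m, where ?'a = 'a] by metis
    moreover have "totient m \<le> degree (?c (cyclotomic m))"
      using lead_coeff_cyclotomic[OF m] degree_cyclotomic[OF m] by (intro le_degree) (simp add: coeff_map_poly)
    moreover have "totient m > 0"
      using m by simp
    ultimately show False by linarith
  qed
  then obtain g where g: "g \<in> U" "poly P g \<noteq> 0" by blast
  have "poly (?c (cyclotomic m) * P) g = 0"
    unfolding eq using Um[OF g(1)] by (simp add: poly_monom)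
  then have root: "poly (?c (cyclotomic m)) g = 0"
    using g by simp
  obtain e where e: "has_order e g" "e dvd m"
    using has_order_exists[of g m] Um g(1) m by blast
  \<comment> \<open>For a proper divisor \<open>e\<close>, all factors of \<open>X ^ e - 1\<close>
    would occur in \<open>P\<close>, making \<open>g\<close> a root of \<open>P\<close>.\<close>
  have "e = m"
  proof (rule ccontr)
    assume "e \<noteq> m"
    then have "e < m" using e m by (auto dest!: dvd_imp_le)
    have e0: "e > 0" using e m by (metis dvd_pos_nat)
    have "{d. d dvd e} \<subseteq> {d. d dvd m \<and> d < m}"
      using dvd_trans[OF _ e(2)] le_less_trans[OF dvd_imp_le[OF _ e0] \<open>e < m\<close>] by blast
    then have "(\<Prod>d | d dvd e. ?c (cyclotomic d)) dvd P"
      unfolding P_def by (rule prod_dvd_prod_subset[rotated]) simp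
    then have "monom 1 e - 1 dvd P"
      using prod_cyclotomic[OF e0]
        by (metis map_poly_of_int_prod map_poly_of_int_diff map_poly_of_int_monom map_poly_of_int_1)
    moreover have "poly (monom 1 e - 1) g = 0"
      using has_orderD(1)[OF e(1), of e] by (simp add: poly_monom)
    ultimately have "poly P g = 0"
      by (metis dvd_def mult_zero_left poly_mult)
    with g show False by simp
  qed
  with e have om: "has_order m g" by simp
  show ?thesis
  proof (rule that[OF om _ root])
    show "m dvd n"
      using g(1) has_orderD(1)[OF om, of n] by (simp add: U_def)
    show "\<exists>i. x = g ^ i" if "x ^ n = 1" for x
      using roots_of_unity_eq_powers[OF om] Um[of x] that unfolding U_def by blast
  qed
qed

section \<open>Two roots of unity with sum one\<close>

text \<open>Expanding the two norm conditions gives \<open>w + cnj w = 1\<close>; multiplying by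
  \<open>w\<close> and using \<open>w * cnj w = 1\<close> finishes.\<close>

lemma sixth_root_of_norm:
  fixes w :: complex
  assumes "norm w = 1" "norm (1 - w) = 1"
  shows "w ^ 2 - w + 1 = 0"
proof -
  have 1: "w * cnj w = 1" "(1 - w) * (1 - cnj w) = 1"
    using assms complex_norm_square[of w] complex_norm_square[of "1 - w"] by simp_all
  then have "w + cnj w = 1"
    by (simp add: algebra_simps)
  then have "w * (w + cnj w) = w"
    by simp
  then show ?thesis
    using 1 by (simp add: algebra_simps power2_eq_square)
qed

text \<open>Division by the cyclotomic polynomial links the two fields: the remainder of
  \<open>H\<close> is an integer constant, equal to the complex norm product \<open>w\<close> and
  mapped to \<open>0\<close> in the given field.\<close>

lemma sum_of_powers_eq_1_imp:
  fixes g :: "'a::field"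
  assumes ord: "has_order m g" and root: "poly (map_poly of_int (cyclotomic m)) g = 0"
    and big: "3 ^ totient m < CHAR('a)" and ij: "g ^ i + g ^ j = 1"
  shows "(g ^ i) ^ 2 - g ^ i + 1 = 0"
proof -
  have m: "m > 0"
    using ord by (rule has_orderD)
  let ?c = "map_poly of_int :: int poly \<Rightarrow> complex poly"
  let ?k = "map_poly of_int :: int poly \<Rightarrow> 'a poly"
  let ?P = "{z::complex. has_order m z}"
  \<comment> \<open>The exponents \<open>a * i\<close> and \<open>a * j\<close> put
    \<open>z ^ a\<close> in place of \<open>z\<close>, so at any primitive root \<open>H\<close>
    multiplies over all of them and takes the same value.\<close>
  define H :: "int poly" where "H = (\<Prod>a\<in>totatives m. 1 - monom 1 (a * i) - monom 1 (a * j))"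
  define w where "w = (\<Prod>z\<in>?P. 1 - z ^ i - z ^ j)"
  have H_complex: "poly (?c H) z = w" if z: "has_order m z" for z
  proof -
    have "poly (?c H) z = (\<Prod>a\<in>totatives m. 1 - (z ^ a) ^ i - (z ^ a) ^ j)"
      by (simp add: H_def map_poly_of_int_prod map_poly_of_int_diff map_poly_of_int_monom
          poly_prod poly_monom power_mult)
    also have "\<dots> = w"
      unfolding w_def by (rule prod.reindex_bij_betw[OF has_order_bij_betw[OF z]])
    finally show ?thesis .
  qed
  obtain q r where qr: "H = cyclotomic m * q + r" "r = 0 \<or> degree r < degree (cyclotomic m)"
    using monic_division[OF lead_coeff_cyclotomic[OF m]] by blast
  have r_complex: "poly (?c r) z = w" if z: "z \<in> ?P" for z
  proof -
    have "(\<Prod>x\<in>?P. poly [:-x, 1:] z) = 0"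
      using z finite_has_order[of m, where ?'a = complex] by (intro prod_zero) auto
    then have "poly (?c (cyclotomic m)) z = 0"
      by (simp add: map_poly_cyclotomic[OF m] complex_cyclotomic_def poly_prod)
    then have "poly (?c H) z = poly (?c r) z"
      by (simp add: qr map_poly_of_int_add map_poly_of_int_mult)
    then show ?thesis
      using H_complex z by simp
  qed
  \<comment> \<open>The remainder has degree below \<open>totient m\<close> but equals
    \<open>w\<close> at \<open>totient m\<close> points.\<close>
  have "?c r = [:w:]"
  proof (rule poly_eqI_degree[where A = ?P])
    show "degree (?c r) < card ?P"
      using qr(2) m by (auto simp: degree_map_poly_of_int card_has_order_complex degree_cyclotomic)
    show "degree [:w:] < card ?P"
      using m by (simp add: card_has_order_complex)
  qed (simp add: r_complex)
  then have "degree r = 0" "w = of_int (coeff r 0)"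
    by (metis degree_map_poly_of_int degree_pCons_0,
        metis coeff_map_poly coeff_pCons_0 of_int_0)
  then obtain c where r: "r = [:c:]" and w: "w = of_int c"
    by (metis coeff_pCons_0 degree_eq_zeroE)
  have n1: "norm z = 1" if "z \<in> ?P" for z
  proof -
    have "norm z ^ m = 1 ^ m"
      using has_orderD(1)[of m z m] that by (simp flip: norm_power)
    then show ?thesis
      using m by (metis norm_ge_zero power_eq_imp_eq_base zero_le_one)
  qed
  have "poly (?k H) g = 0"
  proof -
    have "poly (?k H) g = (\<Prod>a\<in>totatives m. 1 - (g ^ a) ^ i - (g ^ a) ^ j)"
      by (simp add: H_def map_poly_of_int_prod map_poly_of_int_diff map_poly_of_int_monom
          poly_prod poly_monom power_mult)
    \<comment> \<open>The factor for the totative \<open>1\<close> is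
      \<open>1 - g ^ i - g ^ j\<close>.\<close>
    also have "\<dots> = 0"
      using ij m by (intro prod_zero bexI[of _ 1]) (auto simp: algebra_simps)
    finally show ?thesis .
  qed
  then have "of_int c = (0::'a)"
    using root by (simp add: qr r map_poly_of_int_add map_poly_of_int_mult map_poly_pCons)
  then have "int CHAR('a) dvd c"
    by (simp add: of_int_eq_0_iff_char_dvd)
  moreover have "\<bar>c\<bar> < int CHAR('a)"
  proof -
    \<comment> \<open>Each factor is a signed sum of three numbers of absolute value one, and there
      are \<open>totient m\<close> factors.\<close>
    have "norm (1 - z ^ i - z ^ j) \<le> 3" if "z \<in> ?P" for z
      using norm_triangle_ineq4[of "1 - z ^ i" "z ^ j"] norm_triangle_ineq4[of 1 "z ^ i"] n1[OF that]
      by (simp add: norm_power)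
    then have "norm w \<le> (\<Prod>z\<in>?P. 3)"
      unfolding w_def prod_norm[symmetric] by (intro prod_mono) auto
    then have "\<bar>real_of_int c\<bar> \<le> 3 ^ totient m"
      using m by (simp add: w card_has_order_complex)
    then have "\<bar>c\<bar> \<le> 3 ^ totient m"
      by (metis of_int_abs of_int_le_iff of_int_numeral of_int_power)
    also have "\<dots> = int (3 ^ totient m)" by simp
    finally show ?thesis using big by linarith
  qed
  ultimately have "c = 0"
    by (metis abs_of_nat dvd_imp_le_int not_le)
  then have "w = 0" using w by simp
  then have "\<exists>z\<in>?P. 1 - z ^ i - z ^ j = 0"
    unfolding w_def by (subst (asm) prod_zero_iff) (rule finite_has_order)
  then obtain z :: complex where z: "has_order m z" and "1 - z ^ i - z ^ j = 0"
    by blast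
  then have zj: "1 - z ^ i = z ^ j" by simp
  have u: "(z ^ i) ^ 2 - z ^ i + 1 = 0"
    by (rule sixth_root_of_norm) (use z in \<open>simp_all add: zj norm_power n1\<close>)
  define u where "u = z ^ i"
  define v where "v = g ^ i"
  \<comment> \<open>Since \<open>z\<close> and \<open>g\<close> have equal order, so do equal powers
    of them; this carries the order six of \<open>u\<close> over to \<open>v\<close>.\<close>
  have same: "u ^ k = 1 \<longleftrightarrow> v ^ k = 1" for k
    using has_orderD(1)[OF z, of "i * k"] has_orderD(1)[OF ord, of "i * k"]
    by (simp add: u_def v_def flip: power_mult)
  have u2: "u ^ 2 = u - 1"
    using u by (simp add: u_def algebra_simps)
  have u3: "u ^ 3 = -1"
  proof -
    have "u ^ 3 = u ^ 2 * u"
      by (simp add: power3_eq_cube power2_eq_square)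
    also have "\<dots> = (u - 1) * u"
      by (simp only: u2)
    also have "\<dots> = u ^ 2 - u"
      by (simp add: power2_eq_square algebra_simps)
    finally show ?thesis
      by (simp add: u2)
  qed
  then have "u ^ 6 = 1"
    using power_mult[of u 3 2] by simp
  moreover have "u ^ 2 \<noteq> 1"
  proof
    assume "u ^ 2 = 1"
    then have "u = 2" using u2 by simp
    then show False using \<open>u ^ 2 = 1\<close> by simp
  qed
  ultimately have v: "v ^ 6 = 1" "v ^ 3 \<noteq> 1" "v ^ 2 \<noteq> 1"
    using u3 by (simp_all flip: same)
  \<comment> \<open>Order six makes every factor except the last one nonzero.\<close>
  have "(v ^ 3 - 1) * ((v + 1) * (v ^ 2 - v + 1)) = v ^ 6 - 1"
    by (simp add: eval_nat_numeral algebra_simps)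
  moreover have "v + 1 \<noteq> 0"
    using v(3) by (metis add_eq_0_iff2 power2_minus power_one)
  ultimately show ?thesis
    using v(1,2) by (simp add: v_def)
qed

text \<open>Both roots of unity are powers of one generator. Its order \<open>m\<close> divides
  \<open>n\<close>, so \<open>totient m\<close> divides \<open>totient n\<close> and the bound on
  the characteristic passes to \<open>m\<close>.\<close>

lemma sixth_root_of_unity_if_roots_of_unity:
  fixes \<kappa> :: "'a::field"
  assumes "n > 0" "3 ^ totient n < CHAR('a)" "\<kappa> ^ n = 1" "(1 - \<kappa>) ^ n = 1"
  shows "\<kappa> ^ 2 - \<kappa> + 1 = 0"
proof -
  obtain g :: 'a and m where g: "has_order m g" "m dvd n"
    "poly (map_poly of_int (cyclotomic m)) g = 0" "\<And>x. x ^ n = 1 \<Longrightarrow> \<exists>i. x = g ^ i"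
    by (rule roots_of_unity_generator[OF assms(1), where ?'a = 'a]) (rule that)
  obtain i j where ij: "\<kappa> = g ^ i" "1 - \<kappa> = g ^ j"
    using g(4)[OF assms(3)] g(4)[OF assms(4)] by blast
  have "totient m \<le> totient n"
    using g(2) assms(1) by (intro dvd_imp_le totient_dvd) auto
  then have "3 ^ totient m \<le> (3::nat) ^ totient n"
    by (intro power_increasing) auto
  then have "3 ^ totient m < CHAR('a)"
    using assms(2) by linarith
  moreover have "g ^ i + g ^ j = 1"
    using ij by (metis add.commute diff_add_cancel)
  ultimately show ?thesis
    using sum_of_powers_eq_1_imp[OF g(1,3)] ij(1) by blast
qed

section \<open>Lines and cross-ratios\<close>

lemma linear_form_iff:
  "linear_form f \<longleftrightarrow> (\<forall>x y. f (x + y) = f x + f y) \<and> (\<forall>c x. f (c *s x) = c * f x)"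
  unfolding Vector_Spaces.linear_iff
  using vec.vector_space_axioms by (auto simp: vector_space_def algebra_simps)

lemma linear_form_diff: "linear_form f \<Longrightarrow> f (x - y) = f x - f y"
  by (metis diff_add_cancel eq_diff_eq linear_form_iff)

lemma linear_form_scale: "linear_form f \<Longrightarrow> linear_form (\<lambda>x. c * f x)"
  by (simp add: linear_form_iff algebra_simps)

text \<open>A basis of \<open>l\<close> extends to the whole space by a single vector
  \<open>u\<close>; the form is the coordinate at \<open>u\<close>.\<close>

lemma pg_line_kernel:
  assumes "l \<in> pg_lines"
  obtains f where "linear_form f" "l = {x. f x = 0}"
proof -
  have l: "vec.subspace l" "vec.dim l = 2"
    using assms by (auto simp: pg_lines_def)
  obtain B where B: "B \<subseteq> l" "vec.independent B" "l \<subseteq> vec.span B" "card B = 2"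
    using vec.basis_exists[of l] l(2) by metis
  have lB: "l = vec.span B"
    using B l(1) by (metis subset_antisym vec.span_minimal)
  define B' where "B' = vec.extend_basis B"
  have B': "B \<subseteq> B'" "vec.independent B'" "vec.span B' = UNIV"
    using B(2) by (simp_all add: B'_def vec.extend_basis_superset vec.independent_extend_basis
        vec.span_extend_basis)
  have "B \<noteq> B'"
  proof
    assume "B = B'"
    then have "vec.dim (UNIV :: ('a^3) set) = 2"
      using lB B' l(2) by simp
    then have "CARD(3) = 2"
      unfolding vec_dim_card .
    then show False
      by simp
  qed
  then obtain u where u: "u \<in> B'" "u \<notin> B"
    using B' by blast
  have fin: "finite B'"
    using B'(2) vec.finiteI_independent by blast
  have "card (B' - {u}) = 2"
  proof -
    have "card B' = 3"
      using vec.dim_span_eq_card_independent[OF B'(2)] unfolding B'(3) vec_dim_card by simp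
    then show ?thesis
      using u fin by simp
  qed
  moreover have "B \<subseteq> B' - {u}"
    using B' u by blast
  ultimately have Bu: "B = B' - {u}"
    using fin B(4) by (metis card_subset_eq finite_Diff)
  define f where "f x = vec.representation B' x u" for x
  have "linear_form f"
    unfolding linear_form_iff f_def using B'
    by (simp add: vec.representation_add vec.representation_scale)
  moreover have "x \<in> l \<longleftrightarrow> f x = 0" for x
  proof
    assume "x \<in> l"
    then have "vec.representation B' x = vec.representation B x"
      using lB B' by (intro vec.representation_extend) auto
    then show "f x = 0"
      using u by (metis f_def vec.representation_ne_zero)
  next
    assume "f x = 0"
    have "x = (\<Sum>b\<in>B'. vec.representation B' x b *s b)"
      using vec.sum_representation_eq[of B' x B'] B' fin by simp
    also have "\<dots> = (\<Sum>b\<in>B. vec.representation B' x b *s b)"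
      using \<open>f x = 0\<close> u fin by (simp add: Bu f_def sum.remove)
    also have "\<dots> \<in> l"
      unfolding lB by (intro vec.span_sum vec.span_scale vec.span_base)
    finally show "x \<in> l" .
  qed
  ultimately show ?thesis
    using that by blast
qed

text \<open>The form of a line is unique only up to a nonzero factor. Fixing one per line gives
  meaning to products of forms over a component.\<close>

definition line_form :: "('a::field ^ 3) set \<Rightarrow> 'a ^ 3 \<Rightarrow> 'a" where
  "line_form l = (SOME f. linear_form f \<and> (\<forall>x. x \<in> l \<longleftrightarrow> f x = 0))"

lemma
  assumes "l \<in> pg_lines"
  shows linear_line_form: "linear_form (line_form l)"
    and mem_line_iff: "x \<in> l \<longleftrightarrow> line_form l x = 0"
proof -
  obtain f where f: "linear_form f" "l = {x. f x = 0}"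
    by (rule pg_line_kernel[OF assms])
  then have "\<forall>x. x \<in> l \<longleftrightarrow> f x = 0"
    by simp
  with f(1) have "\<exists>f. linear_form f \<and> (\<forall>x. x \<in> l \<longleftrightarrow> f x = 0)"
    by (intro exI[of _ f] conjI)
  then have "linear_form (line_form l) \<and> (\<forall>x. x \<in> l \<longleftrightarrow> line_form l x = 0)"
    unfolding line_form_def by (rule someI_ex)
  then show "linear_form (line_form l)" "x \<in> l \<longleftrightarrow> line_form l x = 0"
    by simp_all
qed

lemma pg_lines_subset_eq:
  assumes "l \<in> pg_lines" "m \<in> pg_lines" "l \<subseteq> m"
  shows "l = m"
  using assms vec.subspace_dim_equal[of l m] by (simp add: pg_lines_def)

lemma pg_line_off_point:
  assumes "l \<in> pg_lines" "m \<in> pg_lines" "l \<noteq> m"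
  obtains x where "x \<in> m" "line_form l x = 1"
proof -
  obtain y where y: "y \<in> m" "y \<notin> l"
    using assms pg_lines_subset_eq by blast
  have "line_form l y \<noteq> 0"
    using y(2) mem_line_iff[OF assms(1)] by blast
  then have "line_form l (inverse (line_form l y) *s y) = 1"
    using linear_line_form[OF assms(1)] by (simp add: linear_form_iff)
  moreover have "inverse (line_form l y) *s y \<in> m"
    using assms(2) y(1) by (simp add: pg_lines_def vec.subspace_scale)
  ultimately show ?thesis
    using that by blast
qed

lemma linear_form_combination:
  assumes l: "l \<in> pg_lines" and m: "m \<in> pg_lines" and "l \<noteq> m"
    and t: "linear_form t" "\<And>x. x \<in> l \<inter> m \<Longrightarrow> t x = 0"
  obtains a b where "\<And>x. t x = a * line_form l x + b * line_form m x"
proof -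
  obtain x where x: "x \<in> m" "line_form l x = 1"
    using pg_line_off_point[OF l m] \<open>l \<noteq> m\<close> by blast
  obtain y where y: "y \<in> l" "line_form m y = 1"
    using pg_line_off_point[OF m l] \<open>l \<noteq> m\<close> by blast
  have "t z = t x * line_form l z + t y * line_form m z" for z
  proof -
    \<comment> \<open>\<open>x\<close> and \<open>y\<close> are dual to the forms of
      \<open>l\<close> and \<open>m\<close>, so the corrected vector is annihilated by both.\<close>
    let ?z = "z - line_form l z *s x - line_form m z *s y"
    have "?z \<in> l \<inter> m"
      using x y mem_line_iff[OF l] mem_line_iff[OF m] linear_line_form[OF l] linear_line_form[OF m]
      by (simp add: linear_form_diff) (simp add: linear_form_iff)
    then have "t ?z = 0"
      by (rule t)
    then show ?thesis
      using t(1) by (simp add: linear_form_diff) (simp add: linear_form_iff algebra_simps)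
  qed
  then show ?thesis
    using that by blast
qed

lemma pg_lines_meet:
  assumes l: "l \<in> pg_lines" and m: "m \<in> pg_lines" and "l \<noteq> m"
    and P: "P \<in> l \<inter> m" "P \<noteq> 0"
  shows "l \<inter> m = vec.span {P}"
proof (rule sym, rule vec.subspace_dim_equal)
  have sub: "vec.subspace l" "vec.subspace m" "vec.dim l = 2"
    using l m by (auto simp: pg_lines_def)
  then show s: "vec.subspace (l \<inter> m)"
    by (simp add: vec.subspace_inter)
  show "vec.span {P} \<subseteq> l \<inter> m"
    using P s by (intro vec.span_minimal) auto
  have "l \<inter> m \<noteq> l"
    using pg_lines_subset_eq[OF l m] \<open>l \<noteq> m\<close> by blast
  then have "vec.dim (l \<inter> m) \<noteq> 2"
    using vec.subspace_dim_equal[OF s sub(1)] sub(3) by auto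
  moreover have "vec.dim (l \<inter> m) \<le> 2"
    using vec.dim_subset[of "l \<inter> m" l] sub(3) by auto
  ultimately show "vec.dim (l \<inter> m) \<le> vec.dim (vec.span {P})"
    using P(2) by simp
qed simp

lemma pg_lines_meet_exists:
  assumes l: "l \<in> pg_lines" and m: "m \<in> pg_lines"
  shows "\<exists>P\<in>l \<inter> m. P \<noteq> 0"
proof -
  have l2: "vec.subspace l" "vec.dim l = 2"
    using l by (auto simp: pg_lines_def)
  obtain B where B: "B \<subseteq> l" "vec.independent B" "card B = 2"
    using vec.basis_exists[of l] l2(2) by metis
  then obtain p q where pq: "B = {p, q}" "p \<noteq> q"
    by (meson card_2_iff)
  let ?f = "line_form m"
  show ?thesis
  proof (cases "?f p = 0")
    case True
    have "p \<noteq> 0"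
      using B(2) pq by (metis insertI1 vec.dependent_zero)
    then show ?thesis
      using True B pq mem_line_iff[OF m] by blast
  next
    case False
    \<comment> \<open>The coefficients are chosen so that the form of \<open>m\<close> cancels;
      independence and \<open>?f p \<noteq> 0\<close> keep the vector nonzero.\<close>
    define P where "P = ?f q *s p - ?f p *s q"
    have "P \<in> l"
      using B(1) pq l2(1) by (simp add: P_def vec.subspace_diff vec.subspace_scale)
    moreover have "P \<in> m"
      using linear_line_form[OF m] mem_line_iff[OF m]
      by (simp add: P_def linear_form_diff) (simp add: linear_form_iff)
    moreover have "P \<noteq> 0"
    proof
      assume "P = 0"
      then have "?f p *s q = ?f q *s p"
        by (simp add: P_def)
      then have "inverse (?f p) *s (?f p *s q) = inverse (?f p) *s (?f q *s p)"
        by simp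
      then have "q = (inverse (?f p) * ?f q) *s p"
        using False by (simp add: vector_smult_assoc)
      then have "q \<in> vec.span {p}"
        by (metis insertI1 vec.span_base vec.span_scale)
      then show False
        using vec.independent_insert[of q "{p}"] B(2) pq by (simp add: insert_commute)
    qed
    ultimately show ?thesis
      by (intro bexI[of _ P] IntI)
  qed
qed

section \<open>Uniqueness and symmetry of the cross-ratio\<close>

text \<open>For suitable \<open>x\<close> on \<open>l3\<close> and \<open>y\<close> on
  \<open>l4\<close>, the memberships of \<open>y - x\<close> in \<open>l1\<close> and of
  \<open>y - \<kappa> *s x\<close> in \<open>l2\<close> express \<open>\<kappa>\<close> by the lines
  alone. Applying the second pair of forms to them yields \<open>\<kappa>'\<close>.\<close>

lemma cross_ratio_unique:
  assumes "is_cross_ratio l1 l2 l3 l4 \<kappa>" "is_cross_ratio l1 l2 l3 l4 \<kappa>'"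
  shows "\<kappa> = \<kappa>'"
proof -
  obtain r w where rw: "linear_form r" "linear_form w" "l1 = {x. r x = 0}" "l2 = {x. w x = 0}"
    "l3 = {x. r x + w x = 0}" "l4 = {x. \<kappa> * r x + w x = 0}"
    using assms(1) unfolding is_cross_ratio_def by blast
  obtain r' w' where rw': "linear_form r'" "linear_form w'" "l1 = {x. r' x = 0}" "l2 = {x. w' x = 0}"
    "l3 = {x. r' x + w' x = 0}" "l4 = {x. \<kappa>' * r' x + w' x = 0}"
    using assms(2) unfolding is_cross_ratio_def by blast
  have lines: "l1 \<in> pg_lines" "l3 \<in> pg_lines" "l4 \<in> pg_lines" "l1 \<noteq> l3" "l1 \<noteq> l4"
    using assms(1) unfolding is_cross_ratio_def by auto
  obtain x where x: "x \<in> l3" "x \<notin> l1"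
    using lines pg_lines_subset_eq by blast
  obtain y0 where y0: "y0 \<in> l4" "y0 \<notin> l1"
    using lines pg_lines_subset_eq by blast
  \<comment> \<open>The scaling achieves \<open>r y = r x\<close>, so that \<open>y - x\<close> lies
    on \<open>l1\<close>.\<close>
  define y where "y = (r x / r y0) *s y0"
  have ry: "r y = r x"
    using rw(1) y0(2) rw(3) by (simp add: y_def linear_form_iff)
  have "y \<in> l4"
    using y0(1) lines(3) by (simp add: y_def pg_lines_def vec.subspace_scale)
  have "y - x \<in> l1"
    using rw ry by (simp add: linear_form_diff)
  then have ry': "r' y = r' x"
    using rw' by (simp add: linear_form_diff)
  have "y - \<kappa> *s x \<in> l2"
  proof -
    have "w x = - r x"
      using x(1) rw(5) by (simp add: eq_neg_iff_add_eq_0 add.commute)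
    moreover have "w y = - (\<kappa> * r x)"
      using \<open>y \<in> l4\<close> rw(6) ry by (simp add: eq_neg_iff_add_eq_0 add.commute)
    ultimately have "w (y - \<kappa> *s x) = 0"
      using rw(2) by (simp add: linear_form_diff) (simp add: linear_form_iff)
    then show ?thesis
      using rw(4) by simp
  qed
  then have "w' y = \<kappa> * w' x"
    using rw' by (simp add: linear_form_diff) (simp add: linear_form_iff)
  moreover have "w' x = - r' x"
    using x(1) rw'(5) by (simp add: eq_neg_iff_add_eq_0 add.commute)
  moreover have "w' y = - (\<kappa>' * r' x)"
    using \<open>y \<in> l4\<close> rw'(6) ry' by (simp add: eq_neg_iff_add_eq_0 add.commute)
  moreover have "r' x \<noteq> 0"
    using x(2) rw'(3) by simp
  ultimately show ?thesis
    by simp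
qed

lemma cross_ratio_swap:
  assumes "is_cross_ratio l1 l2 l3 l4 \<kappa>"
  shows "is_cross_ratio l1 l3 l2 l4 (1 - \<kappa>)"
proof -
  obtain r w where rw: "linear_form r" "linear_form w" "l1 = {x. r x = 0}" "l2 = {x. w x = 0}"
    "l3 = {x. r x + w x = 0}" "l4 = {x. \<kappa> * r x + w x = 0}"
    using assms(1) unfolding is_cross_ratio_def by blast
  \<comment> \<open>The sign makes \<open>v\<close> a form of \<open>l3\<close> for which
    \<open>r + v = - w\<close> is a form of \<open>l2\<close>.\<close>
  define v where "v x = - (r x + w x)" for x
  have v: "linear_form v"
    using rw(1,2) by (simp add: v_def linear_form_iff algebra_simps)
  have "v x = - (r x + w x)" "(1 - \<kappa>) * r x + v x = - (\<kappa> * r x + w x)" "r x + v x = - w x" for x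
    by (simp_all add: v_def algebra_simps)
  then have eqs: "l3 = {x. v x = 0}" "l2 = {x. r x + v x = 0}" "l4 = {x. (1 - \<kappa>) * r x + v x = 0}"
    by (simp_all only: rw neg_equal_0_iff_equal)
  have "{l1, l3, l2, l4} = {l1, l2, l3, l4}"
    by blast
  moreover have "distinct [l1, l3, l2, l4]" "1 - \<kappa> \<noteq> 0" "1 - \<kappa> \<noteq> 1"
    using assms unfolding is_cross_ratio_def by auto
  moreover have "{l1, l2, l3, l4} \<subseteq> pg_lines" "concurrent {l1, l2, l3, l4}"
    using assms unfolding is_cross_ratio_def by blast+
  ultimately show ?thesis
    unfolding is_cross_ratio_def using rw(1,3) v eqs
    by (intro conjI exI[of _ r] exI[of _ v]) simp_all
qed

section \<open>Nets\<close>

definition meet_vector :: "('a::field ^ 3) set \<Rightarrow> 'a ^ 3" where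
  "meet_vector S = (SOME P. P \<in> S \<and> P \<noteq> 0)"

lemma meet_vector:
  assumes "l \<in> pg_lines" "m \<in> pg_lines"
  shows "meet_vector (l \<inter> m) \<in> l" "meet_vector (l \<inter> m) \<in> m" "meet_vector (l \<inter> m) \<noteq> 0"
proof -
  have "meet_vector (l \<inter> m) \<in> l \<inter> m \<and> meet_vector (l \<inter> m) \<noteq> 0"
    unfolding meet_vector_def by (rule someI_ex) (use pg_lines_meet_exists[OF assms] in auto)
  then show "meet_vector (l \<inter> m) \<in> l" "meet_vector (l \<inter> m) \<in> m" "meet_vector (l \<inter> m) \<noteq> 0"
    by auto
qed

lemma pg_lines_meet_subset_iff:
  assumes "l \<in> pg_lines" "m \<in> pg_lines" "l \<noteq> m" "t \<in> pg_lines" "P \<in> l" "P \<in> m" "P \<noteq> 0"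
  shows "l \<inter> m \<subseteq> t \<longleftrightarrow> P \<in> t"
proof
  show "l \<inter> m \<subseteq> t \<Longrightarrow> P \<in> t"
    using assms by blast
  assume "P \<in> t"
  then show "l \<inter> m \<subseteq> t"
    unfolding pg_lines_meet[OF assms(1-3) IntI[OF assms(5,6)] assms(7)]
    using assms(4) by (intro vec.span_minimal) (auto simp: pg_lines_def)
qed

locale net =
  fixes k n :: nat and \<Lambda> :: "nat \<Rightarrow> ('a::field ^ 3) set set"
  assumes is_net: "is_net k n \<Lambda>"
begin

text \<open>The description is meaningful for lines from two distinct components. The index
  \<open>h\<close> may be one of theirs, and then the result is the given line of that
  component.\<close>

definition through :: "nat \<Rightarrow> ('a ^ 3) set \<Rightarrow> ('a ^ 3) set \<Rightarrow> ('a ^ 3) set" where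
  "through h l m = (THE t. t \<in> \<Lambda> h \<and> l \<inter> m \<subseteq> t)"

lemma component:
  assumes "i \<in> {1..k}"
  shows "finite (\<Lambda> i)" "card (\<Lambda> i) = n" "l \<in> \<Lambda> i \<Longrightarrow> l \<in> pg_lines"
proof -
  have "\<Lambda> i \<subseteq> pg_lines \<and> finite (\<Lambda> i) \<and> card (\<Lambda> i) = n"
    using is_net[unfolded is_net_def, THEN conjunct2, THEN conjunct1] assms by (rule bspec)
  then show "finite (\<Lambda> i)" "card (\<Lambda> i) = n" "l \<in> \<Lambda> i \<Longrightarrow> l \<in> pg_lines"
    by (simp_all add: subset_iff)
qed

lemma component_disjoint:
  assumes "i \<in> {1..k}" "j \<in> {1..k}" "i \<noteq> j" "l \<in> \<Lambda> i" "m \<in> \<Lambda> j"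
  shows "l \<noteq> m"
proof -
  have "\<Lambda> i \<inter> \<Lambda> j = {}"
    by (rule is_net[unfolded is_net_def, THEN conjunct2, THEN conjunct2, THEN conjunct1,
          THEN bspec, OF assms(1), THEN bspec, OF assms(2), THEN mp, OF assms(3)])
  then show ?thesis
    using assms(4,5) by auto
qed

lemma through_commute: "through h l m = through h m l"
  by (simp add: through_def Int_commute)

lemma ex1_through:
  assumes "i \<in> {1..k}" "j \<in> {1..k}" "i \<noteq> j" "h \<in> {1..k}" "l \<in> \<Lambda> i" "m \<in> \<Lambda> j"
  shows "\<exists>!t. t \<in> \<Lambda> h \<and> l \<inter> m \<subseteq> t"
  by (rule is_net[unfolded is_net_def, THEN conjunct2, THEN conjunct2, THEN conjunct2,
        THEN bspec, OF assms(1), THEN bspec, OF assms(2), THEN mp, OF assms(3),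
        THEN bspec, OF assms(5), THEN bspec, OF assms(6), THEN bspec, OF assms(4)])

lemma through:
  assumes "i \<in> {1..k}" "j \<in> {1..k}" "i \<noteq> j" "h \<in> {1..k}" "l \<in> \<Lambda> i" "m \<in> \<Lambda> j"
  shows "through h l m \<in> \<Lambda> h" "l \<inter> m \<subseteq> through h l m"
    "t \<in> \<Lambda> h \<Longrightarrow> l \<inter> m \<subseteq> t \<Longrightarrow> through h l m = t"
proof -
  note ex1 = ex1_through[OF assms]
  show "through h l m \<in> \<Lambda> h" "l \<inter> m \<subseteq> through h l m"
    using theI'[OF ex1] by (simp_all add: through_def)
  show "through h l m = t" if "t \<in> \<Lambda> h" "l \<inter> m \<subseteq> t"
    unfolding through_def using ex1 that by (intro the1_equality) simp_all
qed

text \<open>Both lines are the unique line of component \<open>i\<close> through the net point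
  \<open>l \<inter> m\<close>. This is what keeps forms from vanishing at the points where products
  get cancelled.\<close>

lemma same_component_eq:
  assumes ij: "i \<in> {1..k}" "j \<in> {1..k}" "i \<noteq> j" and "l \<in> \<Lambda> i" "l' \<in> \<Lambda> i" "m \<in> \<Lambda> j"
    and "P \<in> l" "P \<in> l'" "P \<in> m" "P \<noteq> 0"
  shows "l = l'"
proof -
  have lines: "l \<in> pg_lines" "l' \<in> pg_lines" "m \<in> pg_lines" "l \<noteq> m"
    using assms component(3) component_disjoint by auto
  have "l \<inter> m \<subseteq> l'"
    using assms lines by (subst pg_lines_meet_subset_iff[where P = P]) auto
  then have "through i l m = l'" "through i l m = l"
    using assms by (intro through(3)[of i j]; auto)+
  then show ?thesis by simp
qed

text \<open>A projection along the fixed line \<open>m\<close>; its inverse is the same construction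
  with \<open>i\<close> and \<open>h\<close> exchanged.\<close>

lemma bij_betw_through:
  assumes "i \<in> {1..k}" "j \<in> {1..k}" "h \<in> {1..k}" "i \<noteq> j" "h \<noteq> j" and m: "m \<in> \<Lambda> j"
  shows "bij_betw (\<lambda>l. through h l m) (\<Lambda> i) (\<Lambda> h)"
proof -
  have inv: "through i (through h l m) m = l" "through h l m \<in> \<Lambda> h"
    if "l \<in> \<Lambda> i" "i \<in> {1..k}" "h \<in> {1..k}" "i \<noteq> j" "h \<noteq> j" for i h l
  proof -
    note t = through[OF that(2) \<open>j \<in> {1..k}\<close> that(4) that(3) that(1) m]
    show th: "through h l m \<in> \<Lambda> h" by (rule t)
    let ?P = "meet_vector (l \<inter> m)"
    have l: "l \<in> pg_lines" "m \<in> pg_lines" "through h l m \<in> pg_lines"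
      using component(3) that m th assms(2) by auto
    have P: "?P \<in> l" "?P \<in> m" "?P \<noteq> 0"
      using meet_vector[OF l(1,2)] by auto
    have "through h l m \<inter> m \<subseteq> l"
      using l P t(2) component_disjoint[OF that(3) assms(2) that(5) th m]
      by (subst pg_lines_meet_subset_iff[where P = ?P]) auto
    then show "through i (through h l m) m = l"
      by (rule through(3)[OF that(3) assms(2) that(5,2) th m that(1)])
  qed
  show ?thesis
    by (rule bij_betw_byWitness[where f' = "\<lambda>t. through i t m"]) (use assms inv in auto)
qed

section \<open>Products of line forms over components\<close>

text \<open>On \<open>m\<close> the forms of components \<open>h\<close> and \<open>i\<close> are
  proportional line by line. The last conclusion leaves out the one factor on each side that
  vanishes at the net point on \<open>l\<close> and \<open>m\<close>, so it still says something
  there.\<close>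

lemma coefficient_product:
  assumes ijh: "i \<in> {1..k}" "j \<in> {1..k}" "h \<in> {1..k}" "i \<noteq> j" "h \<noteq> j"
    and \<alpha>: "\<And>l m x. l \<in> \<Lambda> i \<Longrightarrow> m \<in> \<Lambda> j \<Longrightarrow> x \<in> m \<Longrightarrow>
      line_form (through h l m) x = \<alpha> l m * line_form l x"
    and nz: "\<And>l m. l \<in> \<Lambda> i \<Longrightarrow> m \<in> \<Lambda> j \<Longrightarrow> \<alpha> l m \<noteq> 0"
  obtains a where "a \<noteq> 0" "\<And>m. m \<in> \<Lambda> j \<Longrightarrow> (\<Prod>l\<in>\<Lambda> i. \<alpha> l m) = a"
    "\<And>l m x. l \<in> \<Lambda> i \<Longrightarrow> m \<in> \<Lambda> j \<Longrightarrow> x \<in> m \<Longrightarrow>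
      \<alpha> l m * (\<Prod>t\<in>\<Lambda> h - {through h l m}. line_form t x) = a * (\<Prod>l'\<in>\<Lambda> i - {l}. line_form l' x)"
proof -
  note fin = component(1)[OF ijh(1)]
  have prod_eq: "(\<Prod>t\<in>\<Lambda> h. line_form t x) = (\<Prod>l\<in>\<Lambda> i. \<alpha> l m) * (\<Prod>l\<in>\<Lambda> i. line_form l x)"
    if m: "m \<in> \<Lambda> j" and x: "x \<in> m" for m x
  proof -
    have "(\<Prod>t\<in>\<Lambda> h. line_form t x) = (\<Prod>l\<in>\<Lambda> i. line_form (through h l m) x)"
      by (rule prod.reindex_bij_betw[symmetric], rule bij_betw_through) (use ijh m in auto)
    also have "\<dots> = (\<Prod>l\<in>\<Lambda> i. \<alpha> l m * line_form l x)"
      using \<alpha> m x by (intro prod.cong) auto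
    finally show ?thesis
      by (simp add: prod.distrib)
  qed
  have const: "(\<Prod>l\<in>\<Lambda> i. \<alpha> l m) = (\<Prod>l\<in>\<Lambda> i. \<alpha> l m')" if m: "m \<in> \<Lambda> j" "m' \<in> \<Lambda> j" for m m'
  proof (cases "m = m'")
    case False
    \<comment> \<open>The meet of two lines of component \<open>j\<close> lies on no line of
      component \<open>i\<close>, so the product of forms can be cancelled there.\<close>
    let ?Q = "meet_vector (m \<inter> m')"
    have Q: "?Q \<in> m" "?Q \<in> m'" "?Q \<noteq> 0"
      using meet_vector[OF component(3)[OF ijh(2) m(1)] component(3)[OF ijh(2) m(2)]] by auto
    have "line_form l ?Q \<noteq> 0" if l: "l \<in> \<Lambda> i" for l
    proof
      assume "line_form l ?Q = 0"
      then have "?Q \<in> l"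
        using component(3)[OF ijh(1) l] by (simp add: mem_line_iff)
      then show False
        using same_component_eq[OF ijh(2,1) ijh(4)[symmetric] m l Q(1,2) _ Q(3)] False by simp
    qed
    then have "(\<Prod>l\<in>\<Lambda> i. line_form l ?Q) \<noteq> 0"
      using fin by (simp add: prod_zero_iff)
    moreover have "(\<Prod>l\<in>\<Lambda> i. \<alpha> l m) * (\<Prod>l\<in>\<Lambda> i. line_form l ?Q)
        = (\<Prod>l\<in>\<Lambda> i. \<alpha> l m') * (\<Prod>l\<in>\<Lambda> i. line_form l ?Q)"
      using prod_eq m Q by metis
    ultimately show ?thesis by simp
  qed simp
  have rest: "\<alpha> l m * (\<Prod>t\<in>\<Lambda> h - {through h l m}. line_form t x)
      = (\<Prod>l\<in>\<Lambda> i. \<alpha> l m) * (\<Prod>l'\<in>\<Lambda> i - {l}. line_form l' x)"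
    if l: "l \<in> \<Lambda> i" and m: "m \<in> \<Lambda> j" and x: "x \<in> m" for l m x
  proof -
    have bij: "bij_betw (\<lambda>l. through h l m) (\<Lambda> i) (\<Lambda> h)"
      by (rule bij_betw_through) (use ijh m in auto)
    have "bij_betw (\<lambda>l. through h l m) (\<Lambda> i - {l}) (\<Lambda> h - {through h l m})"
      using bij l by (auto simp: bij_betw_def inj_on_diff inj_on_image_set_diff[where C = "\<Lambda> i"])
    then have "(\<Prod>t\<in>\<Lambda> h - {through h l m}. line_form t x)
        = (\<Prod>l'\<in>\<Lambda> i - {l}. line_form (through h l' m) x)"
      by (rule prod.reindex_bij_betw[symmetric])
    also have "\<dots> = (\<Prod>l'\<in>\<Lambda> i - {l}. \<alpha> l' m * line_form l' x)"
      using \<alpha> m x by (intro prod.cong) auto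
    finally show ?thesis
      using fin l by (simp add: prod.distrib prod.remove[of "\<Lambda> i" l])
  qed
  show ?thesis
  proof (cases "\<Lambda> j = {}")
    \<comment> \<open>Without lines in component \<open>j\<close> only \<open>a \<noteq> 0\<close>
      has content, so \<open>1\<close> serves.\<close>
    case True
    then show ?thesis
      by (intro that[of 1]) auto
  next
    case False
    then obtain m0 where m0: "m0 \<in> \<Lambda> j" by blast
    have a: "(\<Prod>l\<in>\<Lambda> i. \<alpha> l m) = (\<Prod>l\<in>\<Lambda> i. \<alpha> l m0)" if "m \<in> \<Lambda> j" for m
      using const that m0 by blast
    show ?thesis
    proof (rule that)
      show "(\<Prod>l\<in>\<Lambda> i. \<alpha> l m0) \<noteq> 0"
        using fin nz m0 by (simp add: prod_zero_iff)
      show "(\<Prod>l\<in>\<Lambda> i. \<alpha> l m) = (\<Prod>l\<in>\<Lambda> i. \<alpha> l m0)" if "m \<in> \<Lambda> j" for m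
        by (rule a[OF that])
      show "\<alpha> l m * (\<Prod>t\<in>\<Lambda> h - {through h l m}. line_form t x)
        = (\<Prod>l\<in>\<Lambda> i. \<alpha> l m0) * (\<Prod>l'\<in>\<Lambda> i - {l}. line_form l' x)"
        if "l \<in> \<Lambda> i" "m \<in> \<Lambda> j" "x \<in> m" for l m x
        unfolding a[OF that(2), symmetric] by (rule rest[OF that])
    qed
  qed
qed

text \<open>In the last identity the forms of component \<open>h\<close> have been eliminated; that
  component survives only in \<open>\<alpha>\<close>, \<open>\<beta>\<close>, \<open>a\<close> and
  \<open>b\<close>, which allows comparison with a fourth component.\<close>

lemma three_components:
  assumes ijh: "i \<in> {1..k}" "j \<in> {1..k}" "h \<in> {1..k}" "i \<noteq> j" "h \<noteq> i" "h \<noteq> j"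
  obtains \<alpha> \<beta> a b where "a \<noteq> 0" "b \<noteq> 0"
    "\<And>l m x. l \<in> \<Lambda> i \<Longrightarrow> m \<in> \<Lambda> j \<Longrightarrow>
      line_form (through h l m) x = \<alpha> l m * line_form l x + \<beta> l m * line_form m x"
    "\<And>l m. l \<in> \<Lambda> i \<Longrightarrow> m \<in> \<Lambda> j \<Longrightarrow> \<alpha> l m \<noteq> 0 \<and> \<beta> l m \<noteq> 0"
    "\<And>m. m \<in> \<Lambda> j \<Longrightarrow> (\<Prod>l\<in>\<Lambda> i. \<alpha> l m) = a"
    "\<And>l. l \<in> \<Lambda> i \<Longrightarrow> (\<Prod>m\<in>\<Lambda> j. \<beta> l m) = b"
    "\<And>l m x. l \<in> \<Lambda> i \<Longrightarrow> m \<in> \<Lambda> j \<Longrightarrow> x \<in> l \<Longrightarrow> x \<in> m \<Longrightarrow>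
      \<alpha> l m * (b * (\<Prod>m'\<in>\<Lambda> j - {m}. line_form m' x)) = \<beta> l m * (a * (\<Prod>l'\<in>\<Lambda> i - {l}. line_form l' x))"
proof -
  have "\<exists>\<alpha> \<beta>. \<forall>x. line_form (through h l m) x = \<alpha> * line_form l x + \<beta> * line_form m x"
    if lm: "l \<in> \<Lambda> i" "m \<in> \<Lambda> j" for l m
  proof -
    note t = through[OF ijh(1,2,4,3) lm]
    have lines: "l \<in> pg_lines" "m \<in> pg_lines" "through h l m \<in> pg_lines" "l \<noteq> m"
      using component(3) component_disjoint ijh lm t(1) by auto
    obtain \<alpha> \<beta> where "\<And>x. line_form (through h l m) x = \<alpha> * line_form l x + \<beta> * line_form m x"
    proof (rule linear_form_combination[OF lines(1,2,4) linear_line_form[OF lines(3)]])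
      show "line_form (through h l m) x = 0" if "x \<in> l \<inter> m" for x
        using that t(2) mem_line_iff[OF lines(3)] by blast
    qed (rule that)
    then show ?thesis by blast
  qed
  then obtain \<alpha> \<beta> where comb: "\<And>l m x. l \<in> \<Lambda> i \<Longrightarrow> m \<in> \<Lambda> j \<Longrightarrow>
      line_form (through h l m) x = \<alpha> l m * line_form l x + \<beta> l m * line_form m x"
    by metis
  have nz: "\<alpha> l m \<noteq> 0 \<and> \<beta> l m \<noteq> 0" if lm: "l \<in> \<Lambda> i" "m \<in> \<Lambda> j" for l m
  proof -
    note t = through(1)[OF ijh(1,2,4,3) lm]
    have lines: "l \<in> pg_lines" "m \<in> pg_lines" "through h l m \<in> pg_lines"
        "l \<noteq> through h l m" "m \<noteq> through h l m"
      using component(3) component_disjoint[of i h l] component_disjoint[of j h m] ijh lm t by auto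
    have "l \<subseteq> through h l m" if "\<beta> l m = 0"
      using comb[OF lm] that by (auto simp: mem_line_iff[OF lines(1)] mem_line_iff[OF lines(3)])
    moreover have "m \<subseteq> through h l m" if "\<alpha> l m = 0"
      using comb[OF lm] that by (auto simp: mem_line_iff[OF lines(2)] mem_line_iff[OF lines(3)])
    ultimately show ?thesis
      using pg_lines_subset_eq lines by blast
  qed
  have on: "line_form l x = 0" if "i' \<in> {1..k}" "l \<in> \<Lambda> i'" "x \<in> l" for i' l x
    using component(3)[OF that(1,2)] that(3) by (simp add: mem_line_iff)
  have on_m: "line_form (through h l m) x = \<alpha> l m * line_form l x"
    if "l \<in> \<Lambda> i" "m \<in> \<Lambda> j" "x \<in> m" for l m x
    using comb[OF that(1,2)] on[OF ijh(2) that(2,3)] by simp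
  obtain a where a: "a \<noteq> 0" "\<And>m. m \<in> \<Lambda> j \<Longrightarrow> (\<Prod>l\<in>\<Lambda> i. \<alpha> l m) = a"
    "\<And>l m x. l \<in> \<Lambda> i \<Longrightarrow> m \<in> \<Lambda> j \<Longrightarrow> x \<in> m \<Longrightarrow>
      \<alpha> l m * (\<Prod>t\<in>\<Lambda> h - {through h l m}. line_form t x) = a * (\<Prod>l'\<in>\<Lambda> i - {l}. line_form l' x)"
    by (rule coefficient_product[of i j h \<alpha>]) (use ijh on_m nz in auto)
  \<comment> \<open>The same argument with \<open>i\<close> and \<open>j\<close> exchanged,
    restricting to \<open>l\<close> instead of \<open>m\<close>.\<close>
  have on_l: "line_form (through h m l) x = \<beta> l m * line_form m x"
    if "m \<in> \<Lambda> j" "l \<in> \<Lambda> i" "x \<in> l" for m l x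
    using comb[OF that(2,1)] on[OF ijh(1) that(2,3)] by (simp add: through_commute[of h m l])
  obtain b where b: "b \<noteq> 0" "\<And>l. l \<in> \<Lambda> i \<Longrightarrow> (\<Prod>m\<in>\<Lambda> j. \<beta> l m) = b"
    "\<And>m l x. m \<in> \<Lambda> j \<Longrightarrow> l \<in> \<Lambda> i \<Longrightarrow> x \<in> l \<Longrightarrow>
      \<beta> l m * (\<Prod>t\<in>\<Lambda> h - {through h m l}. line_form t x) = b * (\<Prod>m'\<in>\<Lambda> j - {m}. line_form m' x)"
    by (rule coefficient_product[of j i h "\<lambda>m l. \<beta> l m"]) (use ijh on_l nz in auto)
  show ?thesis
  proof (rule that[OF a(1) b(1) comb nz a(2) b(2)])
    fix l m x
    assume lm: "l \<in> \<Lambda> i" "m \<in> \<Lambda> j" "x \<in> l" "x \<in> m"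
    \<comment> \<open>At the net point both product identities contain this factor, through which
      they are linked.\<close>
    let ?C = "\<Prod>t\<in>\<Lambda> h - {through h l m}. line_form t x"
    have "\<alpha> l m * (b * (\<Prod>m'\<in>\<Lambda> j - {m}. line_form m' x)) = \<alpha> l m * (\<beta> l m * ?C)"
      using b(3)[OF lm(2,1,3)] by (simp add: through_commute[of h m l])
    also have "\<dots> = \<beta> l m * (\<alpha> l m * ?C)"
      by (simp add: mult_ac)
    also have "\<dots> = \<beta> l m * (a * (\<Prod>l'\<in>\<Lambda> i - {l}. line_form l' x))"
      by (simp add: a(3)[OF lm(1,2,4)])
    finally show "\<alpha> l m * (b * (\<Prod>m'\<in>\<Lambda> j - {m}. line_form m' x))
        = \<beta> l m * (a * (\<Prod>l'\<in>\<Lambda> i - {l}. line_form l' x))" .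
  qed
qed

lemma four_components:
  assumes "n > 0"
    and ij: "i \<in> {1..k}" "j \<in> {1..k}" "h \<in> {1..k}" "g \<in> {1..k}" "distinct [i, j, h, g]"
  obtains \<kappa> where "\<kappa> ^ (n ^ 2 - n) = 1"
    "\<And>l m. l \<in> \<Lambda> i \<Longrightarrow> m \<in> \<Lambda> j \<Longrightarrow> is_cross_ratio l m (through h l m) (through g l m) \<kappa>"
proof -
  have neq: "i \<noteq> j" "h \<noteq> i" "h \<noteq> j" "g \<noteq> i" "g \<noteq> j" "h \<noteq> g"
    using ij(5) by auto
  obtain \<alpha> \<beta> a b where ab: "a \<noteq> 0" "b \<noteq> 0"
    and t: "\<And>l m x. l \<in> \<Lambda> i \<Longrightarrow> m \<in> \<Lambda> j \<Longrightarrow>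
      line_form (through h l m) x = \<alpha> l m * line_form l x + \<beta> l m * line_form m x"
    and t_nz: "\<And>l m. l \<in> \<Lambda> i \<Longrightarrow> m \<in> \<Lambda> j \<Longrightarrow> \<alpha> l m \<noteq> 0 \<and> \<beta> l m \<noteq> 0"
    and \<alpha>: "\<And>m. m \<in> \<Lambda> j \<Longrightarrow> (\<Prod>l\<in>\<Lambda> i. \<alpha> l m) = a"
    and \<beta>: "\<And>l. l \<in> \<Lambda> i \<Longrightarrow> (\<Prod>m\<in>\<Lambda> j. \<beta> l m) = b"
    and \<alpha>\<beta>: "\<And>l m x. l \<in> \<Lambda> i \<Longrightarrow> m \<in> \<Lambda> j \<Longrightarrow> x \<in> l \<Longrightarrow> x \<in> m \<Longrightarrow>
      \<alpha> l m * (b * (\<Prod>m'\<in>\<Lambda> j - {m}. line_form m' x)) = \<beta> l m * (a * (\<Prod>l'\<in>\<Lambda> i - {l}. line_form l' x))"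
    by (rule three_components[OF ij(1,2,3) neq(1,2,3)]) (rule that)
  obtain \<gamma> \<delta> c d where cd: "c \<noteq> 0" "d \<noteq> 0"
    and s: "\<And>l m x. l \<in> \<Lambda> i \<Longrightarrow> m \<in> \<Lambda> j \<Longrightarrow>
      line_form (through g l m) x = \<gamma> l m * line_form l x + \<delta> l m * line_form m x"
    and s_nz: "\<And>l m. l \<in> \<Lambda> i \<Longrightarrow> m \<in> \<Lambda> j \<Longrightarrow> \<gamma> l m \<noteq> 0 \<and> \<delta> l m \<noteq> 0"
    and \<gamma>: "\<And>m. m \<in> \<Lambda> j \<Longrightarrow> (\<Prod>l\<in>\<Lambda> i. \<gamma> l m) = c"
    and \<delta>: "\<And>l. l \<in> \<Lambda> i \<Longrightarrow> (\<Prod>m\<in>\<Lambda> j. \<delta> l m) = d"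
    and \<gamma>\<delta>: "\<And>l m x. l \<in> \<Lambda> i \<Longrightarrow> m \<in> \<Lambda> j \<Longrightarrow> x \<in> l \<Longrightarrow> x \<in> m \<Longrightarrow>
      \<gamma> l m * (d * (\<Prod>m'\<in>\<Lambda> j - {m}. line_form m' x)) = \<delta> l m * (c * (\<Prod>l'\<in>\<Lambda> i - {l}. line_form l' x))"
    by (rule three_components[OF ij(1,2,4) neq(1,4,5)]) (rule that)
  \<comment> \<open>Eliminating the products over components \<open>i\<close> and \<open>j\<close>
    between the identities for \<open>h\<close> and \<open>g\<close> leaves this quotient, which is
    the same for all net points.\<close>
  define \<kappa> where "\<kappa> = (c * b) / (d * a)"
  have "\<kappa> \<noteq> 0"
    using ab cd by (simp add: \<kappa>_def)
  have \<kappa>: "\<gamma> l m * \<beta> l m = \<kappa> * (\<delta> l m * \<alpha> l m)" if lm: "l \<in> \<Lambda> i" "m \<in> \<Lambda> j" for l m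
  proof -
    let ?P = "meet_vector (l \<inter> m)"
    have P: "?P \<in> l" "?P \<in> m" "?P \<noteq> 0"
      using meet_vector[OF component(3)[OF ij(1) lm(1)] component(3)[OF ij(2) lm(2)]] by auto
    define A where "A = (\<Prod>l'\<in>\<Lambda> i - {l}. line_form l' ?P)"
    define B where "B = (\<Prod>m'\<in>\<Lambda> j - {m}. line_form m' ?P)"
    have "line_form l' ?P \<noteq> 0" if "l' \<in> \<Lambda> i - {l}" for l'
    proof
      assume "line_form l' ?P = 0"
      then have "?P \<in> l'"
        using component(3)[OF ij(1), of l'] that by (simp add: mem_line_iff)
      then have "l = l'"
        using same_component_eq[OF ij(1,2) neq(1) lm(1) _ lm(2) P(1) _ P(2,3)] that by simp
      then show False using that by simp
    qed
    then have "A \<noteq> 0"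
      using component(1)[OF ij(1)] by (simp add: A_def prod_zero_iff)
    have eqs: "\<alpha> l m * (b * B) = \<beta> l m * (a * A)" "\<gamma> l m * (d * B) = \<delta> l m * (c * A)"
      unfolding A_def B_def by (rule \<alpha>\<beta> \<gamma>\<delta>; use lm P in simp)+
    have "B \<noteq> 0"
      using eqs(1) t_nz[OF lm] ab \<open>A \<noteq> 0\<close> by auto
    have "(\<gamma> l m * (d * B)) * (\<beta> l m * (a * A)) = (\<delta> l m * (c * A)) * (\<alpha> l m * (b * B))"
      by (simp only: eqs)
    then have "(A * B) * (\<gamma> l m * \<beta> l m * (d * a)) = (A * B) * (\<delta> l m * \<alpha> l m * (c * b))"
      by (simp add: mult_ac)
    then have "\<gamma> l m * \<beta> l m * (d * a) = \<delta> l m * \<alpha> l m * (c * b)"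
      using \<open>A \<noteq> 0\<close> \<open>B \<noteq> 0\<close> by simp
    then show ?thesis
      using ab cd by (simp add: \<kappa>_def field_simps)
  qed
  have "\<kappa> ^ (n ^ 2 - n) = 1"
  proof -
    have cn: "card (\<Lambda> i) = n" "card (\<Lambda> j) = n"
      using component(2) ij by auto
    \<comment> \<open>\<open>\<beta>\<close> and \<open>\<delta>\<close> have constant products for
      fixed \<open>l\<close>, while \<open>\<alpha>\<close> and \<open>\<gamma>\<close> have them
      for fixed \<open>m\<close>; the latter case exchanges the two products.\<close>
    have p: "(\<Prod>l\<in>\<Lambda> i. \<Prod>m\<in>\<Lambda> j. f l m) = y ^ n"
      if "\<And>l. l \<in> \<Lambda> i \<Longrightarrow> (\<Prod>m\<in>\<Lambda> j. f l m) = y" for f :: "_ \<Rightarrow> _ \<Rightarrow> 'a" and y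
      using that cn by simp
    have q: "(\<Prod>l\<in>\<Lambda> i. \<Prod>m\<in>\<Lambda> j. f l m) = y ^ n"
      if "\<And>m. m \<in> \<Lambda> j \<Longrightarrow> (\<Prod>l\<in>\<Lambda> i. f l m) = y" for f :: "_ \<Rightarrow> _ \<Rightarrow> 'a" and y
      using that cn by (subst prod.swap) simp
    have "(\<Prod>l\<in>\<Lambda> i. \<Prod>m\<in>\<Lambda> j. \<gamma> l m * \<beta> l m) = (\<Prod>l\<in>\<Lambda> i. \<Prod>m\<in>\<Lambda> j. \<kappa> * (\<delta> l m * \<alpha> l m))"
      using \<kappa> by (intro prod.cong refl)
    then have "(\<Prod>l\<in>\<Lambda> i. \<Prod>m\<in>\<Lambda> j. \<gamma> l m) * (\<Prod>l\<in>\<Lambda> i. \<Prod>m\<in>\<Lambda> j. \<beta> l m)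
        = (\<kappa> ^ n) ^ n * ((\<Prod>l\<in>\<Lambda> i. \<Prod>m\<in>\<Lambda> j. \<delta> l m) * (\<Prod>l\<in>\<Lambda> i. \<Prod>m\<in>\<Lambda> j. \<alpha> l m))"
      by (simp add: prod.distrib cn)
    moreover have "(\<Prod>l\<in>\<Lambda> i. \<Prod>m\<in>\<Lambda> j. \<gamma> l m) = c ^ n" "(\<Prod>l\<in>\<Lambda> i. \<Prod>m\<in>\<Lambda> j. \<alpha> l m) = a ^ n"
      using \<gamma> \<alpha> by (blast intro: q)+
    moreover have "(\<Prod>l\<in>\<Lambda> i. \<Prod>m\<in>\<Lambda> j. \<beta> l m) = b ^ n" "(\<Prod>l\<in>\<Lambda> i. \<Prod>m\<in>\<Lambda> j. \<delta> l m) = d ^ n"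
      using \<beta> \<delta> by (blast intro: p)+
    ultimately have "c ^ n * b ^ n = (\<kappa> ^ n) ^ n * (d ^ n * a ^ n)"
      by (simp only:)
    \<comment> \<open>The definition of \<open>\<kappa>\<close> gives this with exponent
      \<open>n\<close>, the product over all net points with exponent \<open>n ^ 2\<close>.\<close>
    moreover have "\<kappa> ^ n * (d ^ n * a ^ n) = c ^ n * b ^ n"
      using ab cd by (simp add: \<kappa>_def power_divide power_mult_distrib)
    ultimately have "\<kappa> ^ (n ^ 2) = \<kappa> ^ n"
      using ab cd by (simp add: power2_eq_square flip: power_mult)
    moreover have "n \<le> n ^ 2"
      by (simp add: power2_eq_square)
    ultimately show ?thesis
      using \<open>\<kappa> \<noteq> 0\<close> by (simp add: power_diff)
  qed
  moreover have "is_cross_ratio l m (through h l m) (through g l m) \<kappa>"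
    if lm: "l \<in> \<Lambda> i" "m \<in> \<Lambda> j" for l m
  proof -
    let ?t = "through h l m" and ?s = "through g l m"
    note th = through[OF ij(1,2) neq(1) ij(3) lm] and sg = through[OF ij(1,2) neq(1) ij(4) lm]
    have lines: "l \<in> pg_lines" "m \<in> pg_lines" "?t \<in> pg_lines" "?s \<in> pg_lines"
      using component(3) ij lm th(1) sg(1) by blast+
    have dist: "l \<noteq> m" "l \<noteq> ?t" "l \<noteq> ?s" "m \<noteq> ?t" "m \<noteq> ?s" "?t \<noteq> ?s"
      by (rule component_disjoint[OF ij(1,2) neq(1) lm(1,2)]
            component_disjoint[OF ij(1,3) neq(2)[symmetric] lm(1) th(1)]
            component_disjoint[OF ij(1,4) neq(4)[symmetric] lm(1) sg(1)]
            component_disjoint[OF ij(2,3) neq(3)[symmetric] lm(2) th(1)]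
            component_disjoint[OF ij(2,4) neq(5)[symmetric] lm(2) sg(1)]
            component_disjoint[OF ij(3,4) neq(6) th(1) sg(1)])+
    let ?P = "meet_vector (l \<inter> m)"
    have P: "?P \<in> l" "?P \<in> m" "?P \<noteq> 0"
      using meet_vector[OF lines(1,2)] by auto
    have conc: "concurrent {l, m, ?t, ?s}"
      unfolding concurrent_def
    proof (rule bexI)
      have "l \<inter> m = vec.span {?P}"
        using pg_lines_meet[OF lines(1,2) dist(1)] P by blast
      then show "\<forall>l'\<in>{l, m, ?t, ?s}. vec.span {?P} \<subseteq> l'"
        using th(2) sg(2) by auto
      show "vec.span {?P} \<in> pg_points"
        using P(3) by (simp add: pg_points_def)
    qed
    have nz: "\<alpha> l m \<noteq> 0" "\<beta> l m \<noteq> 0" "\<gamma> l m \<noteq> 0" "\<delta> l m \<noteq> 0"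
      using t_nz[OF lm] s_nz[OF lm] by auto
    have s': "\<kappa> * (\<alpha> l m * line_form l x) + \<beta> l m * line_form m x
        = \<beta> l m / \<delta> l m * line_form ?s x" for x
    proof -
      have "\<kappa> * \<alpha> l m = \<beta> l m / \<delta> l m * \<gamma> l m"
        using \<kappa>[OF lm] nz by (simp add: field_simps)
      then have "\<kappa> * \<alpha> l m * line_form l x = \<beta> l m / \<delta> l m * \<gamma> l m * line_form l x"
        by simp
      then show ?thesis
        using nz by (simp add: s[OF lm] distrib_left mult.assoc)
    qed
    have "\<kappa> \<noteq> 1"
    proof
      assume "\<kappa> = 1"
      then have "line_form ?t x = \<beta> l m / \<delta> l m * line_form ?s x" for x
        using s'[of x] t[OF lm, of x] by simp
      then have "?t \<subseteq> ?s"
        using nz mem_line_iff[OF lines(3)] mem_line_iff[OF lines(4)] by auto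
      then show False
        using dist(6) pg_lines_subset_eq[OF lines(3,4)] by blast
    qed
    \<comment> \<open>The factors make \<open>?r + ?w\<close> the form of \<open>?t\<close>; then
      \<open>\<kappa> * ?r + ?w\<close> is a nonzero multiple of the form of
      \<open>?s\<close>.\<close>
    let ?r = "\<lambda>x. \<alpha> l m * line_form l x" and ?w = "\<lambda>x. \<beta> l m * line_form m x"
    have "linear_form ?r" "linear_form ?w"
      using lines by (auto intro: linear_form_scale linear_line_form)
    moreover have "l = {x. ?r x = 0}" "m = {x. ?w x = 0}" "?t = {x. ?r x + ?w x = 0}"
      "?s = {x. \<kappa> * ?r x + ?w x = 0}"
      using nz mem_line_iff[OF lines(1)] mem_line_iff[OF lines(2)] mem_line_iff[OF lines(3)]
        mem_line_iff[OF lines(4)] unfolding s' t[OF lm, symmetric] by auto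
    ultimately have "\<exists>r w. linear_form r \<and> linear_form w \<and> l = {x. r x = 0} \<and> m = {x. w x = 0} \<and>
        ?t = {x. r x + w x = 0} \<and> ?s = {x. \<kappa> * r x + w x = 0}"
      by (intro exI[of _ ?r] exI[of _ ?w] conjI)
    then show ?thesis
      unfolding is_cross_ratio_def using conc lines dist \<open>\<kappa> \<noteq> 0\<close> \<open>\<kappa> \<noteq> 1\<close>
      by (intro conjI) simp_all
  qed
  ultimately show ?thesis
    using that by blast
qed

text \<open>A net point may be given by lines of other components. Any nonzero vector in it spans
  both meets.\<close>

lemma net_point_eq_meet:
  assumes "P \<in> net_points k \<Lambda>" and ij: "i \<in> {1..k}" "j \<in> {1..k}" "i \<noteq> j"
    and lm: "l \<in> \<Lambda> i" "m \<in> \<Lambda> j" and "P \<subseteq> l" "P \<subseteq> m"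
  shows "P = l \<inter> m"
proof -
  obtain l' m' i' j' where P: "P = l' \<inter> m'" and ij': "i' \<in> {1..k}" "j' \<in> {1..k}" "i' \<noteq> j'"
    and lm': "l' \<in> \<Lambda> i'" "m' \<in> \<Lambda> j'"
    using assms(1) unfolding net_points_def by blast
  have lines: "l' \<in> pg_lines" "m' \<in> pg_lines" "l \<in> pg_lines" "m \<in> pg_lines" "l' \<noteq> m'" "l \<noteq> m"
    using component(3) component_disjoint ij ij' lm lm' by auto
  let ?Q = "meet_vector (l' \<inter> m')"
  have Q: "?Q \<in> l' \<inter> m'" "?Q \<noteq> 0"
    using meet_vector[OF lines(1,2)] by auto
  then have "?Q \<in> l \<inter> m"
    using P assms(7,8) by blast
  then show ?thesis
    unfolding P using pg_lines_meet[OF lines(1,2,5) Q] pg_lines_meet[OF lines(3,4,6) _ Q(2)]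
    by (metis (no_types))
qed

end

section \<open>The constant cross-ratio of a 4-net\<close>

theorem theorem4p3:
  fixes n p :: nat and \<Lambda> :: "nat \<Rightarrow> ('a::field ^ 3) set set"
  assumes "n \<ge> 2"
    and "CHAR('a) = p" and "p > 0"
    and "p > 3 ^ totient (n^2 - n)"
    and "is_net 4 n \<Lambda>"
  shows "(\<exists>s::'a. s^2 = -3) \<and>
    (\<exists>!\<kappa>. is_constant_cross_ratio \<Lambda> \<kappa>) \<and>
    (\<forall>\<kappa>. is_constant_cross_ratio \<Lambda> \<kappa> \<longrightarrow> \<kappa>^2 - \<kappa> + 1 = 0)"
proof -
  interpret net 4 n \<Lambda>
    by unfold_locales fact
  have n: "n > 0"
    using assms(1) by simp
  obtain \<kappa> where \<kappa>: "\<kappa> ^ (n ^ 2 - n) = 1"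
    and cr: "\<And>l m. l \<in> \<Lambda> 1 \<Longrightarrow> m \<in> \<Lambda> 2 \<Longrightarrow> is_cross_ratio l m (through 3 l m) (through 4 l m) \<kappa>"
    by (rule four_components[OF n, of 1 2 3 4]) auto
  \<comment> \<open>Exchanging the second and third components yields a root of unity that turns out
    to be \<open>1 - \<kappa>\<close>.\<close>
  obtain \<kappa>' where \<kappa>': "\<kappa>' ^ (n ^ 2 - n) = 1"
    and cr': "\<And>l m. l \<in> \<Lambda> 1 \<Longrightarrow> m \<in> \<Lambda> 3 \<Longrightarrow> is_cross_ratio l m (through 2 l m) (through 4 l m) \<kappa>'"
    by (rule four_components[OF n, of 1 3 2 4]) auto
  have "\<Lambda> 1 \<noteq> {}" "\<Lambda> 2 \<noteq> {}"
    using component(2)[of 1] component(2)[of 2] n by auto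
  then obtain l1 l2 where l1: "l1 \<in> \<Lambda> 1" and l2: "l2 \<in> \<Lambda> 2"
    by blast
  define l3 where "l3 = through 3 l1 l2"
  define l4 where "l4 = through 4 l1 l2"
  have l3: "l3 \<in> \<Lambda> 3" "l1 \<inter> l2 \<subseteq> l3" and l4: "l4 \<in> \<Lambda> 4" "l1 \<inter> l2 \<subseteq> l4"
    using through(1,2)[of 1 2 3 l1 l2] through(1,2)[of 1 2 4 l1 l2] l1 l2
    by (simp_all add: l3_def l4_def)
  have cr1: "is_cross_ratio l1 l2 l3 l4 \<kappa>"
    unfolding l3_def l4_def by (rule cr[OF l1 l2])
  \<comment> \<open>Both values are constant over the net, so comparing them at the single point
    \<open>l1 \<inter> l2\<close> suffices.\<close>
  have "\<kappa>' = 1 - \<kappa>"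
  proof (rule cross_ratio_unique)
    show "is_cross_ratio l1 l3 l2 l4 (1 - \<kappa>)"
      by (rule cross_ratio_swap[OF cr1])
    have lines: "l1 \<in> pg_lines" "l2 \<in> pg_lines" "l3 \<in> pg_lines" "l4 \<in> pg_lines" "l1 \<noteq> l2" "l1 \<noteq> l3"
      using cr1 by (auto simp: is_cross_ratio_def)
    let ?P = "meet_vector (l1 \<inter> l2)"
    have P: "?P \<in> l1" "?P \<in> l2" "?P \<noteq> 0"
      using meet_vector[OF lines(1,2)] by auto
    have "?P \<in> l3" "?P \<in> l4"
      using P l3(2) l4(2) by auto
    then have "l1 \<inter> l3 \<subseteq> l2" "l1 \<inter> l3 \<subseteq> l4"
      using pg_lines_meet_subset_iff[OF lines(1,3,6) _ P(1) _ P(3)] lines P(2) by auto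
    then have "through 2 l1 l3 = l2" "through 4 l1 l3 = l4"
      using l1 l2 l3(1) l4(1) by (intro through(3)[of 1 3]; simp)+
    then show "is_cross_ratio l1 l3 l2 l4 \<kappa>'"
      using cr'[OF l1 l3(1)] by simp
  qed
  have "n ^ 2 - n > 0"
  proof -
    have "n * 1 < n * n"
      using assms(1) by (intro mult_strict_left_mono) auto
    then show ?thesis
      by (simp add: power2_eq_square)
  qed
  then have root: "\<kappa> ^ 2 - \<kappa> + 1 = 0"
    using assms(2,4) \<kappa> \<kappa>' \<open>\<kappa>' = 1 - \<kappa>\<close>
    by (intro sixth_root_of_unity_if_roots_of_unity[of "n ^ 2 - n"]) simp_all
  have const: "is_constant_cross_ratio \<Lambda> \<kappa>"
    unfolding is_constant_cross_ratio_def
  proof (intro ballI impI)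
    fix P m1 m2 m3 m4
    assume P: "P \<in> net_points 4 \<Lambda>" and m: "m1 \<in> \<Lambda> 1" "m2 \<in> \<Lambda> 2" "m3 \<in> \<Lambda> 3" "m4 \<in> \<Lambda> 4"
      and sub: "P \<subseteq> m1 \<and> P \<subseteq> m2 \<and> P \<subseteq> m3 \<and> P \<subseteq> m4"
    have "P = m1 \<inter> m2"
      using P m sub by (intro net_point_eq_meet[of P 1 2]) auto
    then have "through 3 m1 m2 = m3" "through 4 m1 m2 = m4"
      using m sub by (intro through(3)[of 1 2]; simp)+
    then show "is_cross_ratio m1 m2 m3 m4 \<kappa>"
      using cr[OF m(1,2)] by simp
  qed
  have uniq: "\<mu> = \<kappa>" if "is_constant_cross_ratio \<Lambda> \<mu>" for \<mu>
  proof (rule cross_ratio_unique[OF _ cr1])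
    \<comment> \<open>Uniqueness needs an actual net point, since a constant cross-ratio is defined
      by quantifying over them.\<close>
    have "l1 \<inter> l2 \<in> net_points 4 \<Lambda>"
      unfolding net_points_def using l1 l2
      by (intro CollectI exI[of _ l1] exI[of _ l2] exI[of _ "1::nat"] exI[of _ "2::nat"]) auto
    then show "is_cross_ratio l1 l2 l3 l4 \<mu>"
      using that l1 l2 l3 l4 unfolding is_constant_cross_ratio_def by auto
  qed
  \<comment> \<open>Completing the square exhibits \<open>2 * \<kappa> - 1\<close> as a square root
    of \<open>-3\<close>.\<close>
  have "(2 * \<kappa> - 1) ^ 2 = 4 * (\<kappa> ^ 2 - \<kappa> + 1) - 3"
    by (simp add: power2_eq_square algebra_simps)
  then have "(2 * \<kappa> - 1) ^ 2 = -3"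
    using root by simp
  then show ?thesis
    using const uniq root by blast
qed

end
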